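(* Let $n,d$ be positive integers with $d\le n(n-1)$. Then $UL(n,d)$ is generated as a Lie algebra and $\mathfrak{sl}_n$-module (i.e. the smallest $\mathfrak{sl}_n$-invariant Lie subalgebra containing them is all of $UL(n,d)$) by the elements $\mathrm{AD}_{x_1^k}$ for $1\le k<d$ and, if $n\ge 3$, the element $\Delta_{x_1,[x_2,x_3]}$.
   Context: Let $V$ be the real vector space with basis $x_1,\dots,x_n$, $L[V]=\bigoplus_{i\ge1}L[V]^{(i)}$ the free Lie algebra on $V$ graded by degree, and $L[V,d]=L[V]/\bigoplus_{i>d}L[V]^{(i)}$ the free nilpotent Lie algebra of class $d$. A derivation has degree $k$ if it raises degrees by $k$. The derivation algebra of $L[V,d]$ decomposes as $\bigoplus_{k=0}^{d-1}\mathrm{Der}^{(k)}$ with $\mathrm{Der}^{(k)}\cong\mathrm{Hom}(V,L[V]^{(k+1)})$ (a derivation being determined by its arbitrary values on $V$), and $\mathrm{Der}^{(0)}=\mathfrak{gl}_n$. Put $UL(n,d)=UL[V,d]=\bigoplus_{k=1}^{d-1}\mathrm{Der}^{(k)}$; $\mathfrak{sl}_n\subset\mathfrak{gl}_n$ acts on it by the bracket. $\mathrm{AD}_{x_1^k}$ is the derivation with $\mathrm{AD}_{x_1^k}(x)=\mathrm{ad}(x_1)^k(x)$ for every $x\in V$, where $\mathrm{ad}(f)(g)=[f,g]$. $\Delta_{x_1,[x_2,x_3]}$ is the derivation sending $x_1\mapsto[x_2,x_3]$ and $x_j\mapsto0$ for $j\ne1$. *)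

theory Defs
  imports "HOL-Analysis.Analysis" "HOL-Library.Poly_Mapping"
begin

class real_lie_algebra = real_vector +
  fixes lie :: "'a \<Rightarrow> 'a \<Rightarrow> 'a"
  assumes lie_add_left: "lie (a + b) c = lie a c + lie b c"
    and lie_add_right: "lie a (b + c) = lie a b + lie a c"
    and lie_scale_left: "lie (r *\<^sub>R a) b = r *\<^sub>R lie a b"
    and lie_scale_right: "lie a (r *\<^sub>R b) = r *\<^sub>R lie a b"
    and lie_self: "lie a a = 0"
    and lie_jacobi: "lie a (lie b c) + lie b (lie c a) + lie c (lie a b) = 0"

definition lie_subalgebra :: "'l::real_lie_algebra set \<Rightarrow> bool" where
  "lie_subalgebra S \<longleftrightarrow> subspace S \<and> (\<forall>a\<in>S. \<forall>b\<in>S. lie a b \<in> S)"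

lemma lie_zero_left [simp]: "lie 0 a = 0"
  using lie_scale_left[of 0 0 a] by simp

lemma lie_zero_right [simp]: "lie a 0 = 0"
  using lie_scale_right[of a 0 0] by simp

lemma lie_minus_left: "lie (- a) b = - lie a b"
  using lie_scale_left[of "-1" a b] by simp

lemma lie_minus_right: "lie a (- b) = - lie a b"
  using lie_scale_right[of a "-1" b] by simp

lemma lie_diff_left: "lie (a - b) c = lie a c - lie b c"
  using lie_add_left[of a "- b" c] by (simp add: lie_minus_left)

lemma lie_diff_right: "lie a (b - c) = lie a b - lie a c"
  using lie_add_right[of a b "- c"] by (simp add: lie_minus_right)

lemma lie_anticomm: "lie b a = - lie a b"
proof -
  have "lie (a + b) (a + b) = lie a b + lie b a"
    by (simp only: lie_add_left lie_add_right) (simp add: lie_self)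
  then show ?thesis
    by (simp only: lie_self eq_neg_iff_add_eq_0 add.commute)
qed

lemma linear_lie_right: "linear (lie a)"
  by (rule linearI) (simp_all add: lie_add_right lie_scale_right)

lemma linear_lie_left: "linear (\<lambda>a. lie a b)"
  by (rule linearI) (simp_all add: lie_add_left lie_scale_left)

datatype 'a magma = Gen 'a | Br "'a magma" "'a magma"

primrec leaves :: "'a magma \<Rightarrow> nat" where
  "leaves (Gen i) = 1"
| "leaves (Br s t) = leaves s + leaves t"

lemma leaves_pos: "leaves t \<ge> 1"
  by (induction t) auto

instantiation poly_mapping :: (type, real_vector) real_vector
begin

lift_definition scaleR_poly_mapping :: "real \<Rightarrow> ('a \<Rightarrow>\<^sub>0 'b) \<Rightarrow> ('a \<Rightarrow>\<^sub>0 'b)"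
  is "\<lambda>r f k. r *\<^sub>R f k"
  by (erule finite_subset[rotated]) auto

instance
  by standard (transfer; simp add: scaleR_right_distrib scaleR_left_distrib)+

end

lemma lookup_scaleR: "Poly_Mapping.lookup (r *\<^sub>R f) k = r *\<^sub>R Poly_Mapping.lookup f k"
  by transfer simp

definition linext :: "('m \<Rightarrow> 'v::real_vector) \<Rightarrow> ('m \<Rightarrow>\<^sub>0 real) \<Rightarrow> 'v" where
  "linext h f = (\<Sum>t\<in>Poly_Mapping.keys f. Poly_Mapping.lookup f t *\<^sub>R h t)"

lemma linext_superset:
  assumes "finite A" "Poly_Mapping.keys f \<subseteq> A"
  shows "linext h f = (\<Sum>t\<in>A. Poly_Mapping.lookup f t *\<^sub>R h t)"
  unfolding linext_def using assms
  by (intro sum.mono_neutral_left) (auto simp: in_keys_iff)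

lemma linear_linext: "linear (linext h)"
proof (rule linearI)
  fix f g :: "'a \<Rightarrow>\<^sub>0 real" and r :: real
  let ?A = "Poly_Mapping.keys f \<union> Poly_Mapping.keys g \<union> Poly_Mapping.keys (f + g) \<union> Poly_Mapping.keys (r *\<^sub>R f)"
  have fin: "finite ?A" by simp
  show "linext h (f + g) = linext h f + linext h g"
    by (subst (1 2 3) linext_superset[OF fin])
       (auto simp: lookup_add scaleR_left_distrib sum.distrib)
  show "linext h (r *\<^sub>R f) = r *\<^sub>R linext h f"
    by (subst (1 2) linext_superset[OF fin])
       (auto simp: lookup_scaleR scaleR_sum_right)
qed

lemmas linext_add = linear_add[OF linear_linext]
  and linext_scale = linear_scale[OF linear_linext]
  and linext_zero = linear_0[OF linear_linext]

lemma linext_single [simp]: "linext h (Poly_Mapping.single t c) = c *\<^sub>R h t"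
  by (cases "c = 0") (simp_all add: linext_def)

lemma linext_unique:
  assumes "linear T"
  shows "T f = linext (\<lambda>t. T (Poly_Mapping.single t 1)) f"
proof -
  have "f = (\<Sum>t\<in>Poly_Mapping.keys f. Poly_Mapping.lookup f t *\<^sub>R Poly_Mapping.single t 1)"
    by (rule poly_mapping_eqI)
       (auto simp: lookup_sum lookup_scaleR lookup_single when_def in_keys_iff
          if_distrib sum.delta cong: if_cong)
  then have "T f = T (\<Sum>t\<in>Poly_Mapping.keys f. Poly_Mapping.lookup f t *\<^sub>R Poly_Mapping.single t 1)"
    by simp
  then show ?thesis
    by (simp add: linext_def linear_sum[OF assms] linear_scale[OF assms])
qed

definition mmul :: "('a magma \<Rightarrow>\<^sub>0 real) \<Rightarrow> ('a magma \<Rightarrow>\<^sub>0 real) \<Rightarrow> ('a magma \<Rightarrow>\<^sub>0 real)" where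
  "mmul f g = linext (\<lambda>s. linext (\<lambda>t. Poly_Mapping.single (Br s t) 1) g) f"

lemma mmul_add_left: "mmul (f + f') g = mmul f g + mmul f' g"
  and mmul_scale_left: "mmul (r *\<^sub>R f) g = r *\<^sub>R mmul f g"
  by (simp_all add: mmul_def linext_add linext_scale)

lemma mmul_add_right: "mmul f (g + g') = mmul f g + mmul f g'"
  and mmul_scale_right: "mmul f (r *\<^sub>R g) = r *\<^sub>R mmul f g"
  by (simp_all add: mmul_def linext_def[of _ f] linext_add linext_scale
      scaleR_right_distrib sum.distrib scaleR_sum_right mult.commute)

lemma mmul_single:
  "mmul (Poly_Mapping.single s 1) (Poly_Mapping.single t 1) = Poly_Mapping.single (Br s t) 1"
  by (simp add: mmul_def)

lemma mmul_diff_left: "mmul (f - f') g = mmul f g - mmul f' g"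
  using mmul_add_left[of "f - f'" f' g] by (simp add: algebra_simps)

lemma mmul_diff_right: "mmul f (g - g') = mmul f g - mmul f g'"
  using mmul_add_right[of f "g - g'" g'] by (simp add: algebra_simps)

text \<open>Formal linear combinations of nonassociative words modulo the two-sided ideal generated by
  the alternating and Jacobi relations; the Lie degree of a word is its number of leaves.\<close>

inductive_set lie_ideal :: "('a magma \<Rightarrow>\<^sub>0 real) set" where
  zero: "0 \<in> lie_ideal"
| add: "f \<in> lie_ideal \<Longrightarrow> g \<in> lie_ideal \<Longrightarrow> f + g \<in> lie_ideal"
| scale: "f \<in> lie_ideal \<Longrightarrow> r *\<^sub>R f \<in> lie_ideal"
| mult_left: "f \<in> lie_ideal \<Longrightarrow> mmul g f \<in> lie_ideal"
| mult_right: "f \<in> lie_ideal \<Longrightarrow> mmul f g \<in> lie_ideal"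
| self: "mmul f f \<in> lie_ideal"
| jacobi: "mmul f (mmul g h) + mmul g (mmul h f) + mmul h (mmul f g) \<in> lie_ideal"

lemma lie_ideal_minus: "f \<in> lie_ideal \<Longrightarrow> - f \<in> lie_ideal"
  using lie_ideal.scale[of f "-1"] by simp

quotient_type 'a free_lie = "'a magma \<Rightarrow>\<^sub>0 real" / "\<lambda>f g. f - g \<in> lie_ideal"
proof (rule equivpI)
  show "reflp (\<lambda>f g :: 'a magma \<Rightarrow>\<^sub>0 real. f - g \<in> lie_ideal)"
    by (simp add: reflp_def lie_ideal.zero)
  show "symp (\<lambda>f g :: 'a magma \<Rightarrow>\<^sub>0 real. f - g \<in> lie_ideal)"
    by (metis (lifting) lie_ideal_minus minus_diff_eq sympI)
  show "transp (\<lambda>f g :: 'a magma \<Rightarrow>\<^sub>0 real. f - g \<in> lie_ideal)"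
    by (rule transpI) (drule (1) lie_ideal.add, simp)
qed

instantiation free_lie :: (type) real_lie_algebra
begin

lift_definition zero_free_lie :: "'a free_lie" is 0 .

lift_definition plus_free_lie :: "'a free_lie \<Rightarrow> 'a free_lie \<Rightarrow> 'a free_lie" is "(+)"
  by (metis add_diff_add lie_ideal.add)

lift_definition uminus_free_lie :: "'a free_lie \<Rightarrow> 'a free_lie" is uminus
  by (metis lie_ideal_minus minus_diff_minus)

lift_definition minus_free_lie :: "'a free_lie \<Rightarrow> 'a free_lie \<Rightarrow> 'a free_lie" is "(-)"
proof -
  fix f f' g g' :: "'a magma \<Rightarrow>\<^sub>0 real"
  assume "f - f' \<in> lie_ideal" "g - g' \<in> lie_ideal"
  then have "(f - f') + - (g - g') \<in> lie_ideal"
    by (intro lie_ideal.add lie_ideal_minus)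
  then show "f - g - (f' - g') \<in> lie_ideal"
    by (simp add: algebra_simps)
qed

lift_definition scaleR_free_lie :: "real \<Rightarrow> 'a free_lie \<Rightarrow> 'a free_lie" is "(*\<^sub>R)"
  by (metis lie_ideal.scale scaleR_diff_right)

lift_definition lie_free_lie :: "'a free_lie \<Rightarrow> 'a free_lie \<Rightarrow> 'a free_lie" is mmul
proof -
  fix f f' g g' :: "'a magma \<Rightarrow>\<^sub>0 real"
  assume "f - f' \<in> lie_ideal" "g - g' \<in> lie_ideal"
  then have "mmul (f - f') g + mmul f' (g - g') \<in> lie_ideal"
    by (intro lie_ideal.intros)
  then show "mmul f g - mmul f' g' \<in> lie_ideal"
    by (simp add: mmul_diff_left mmul_diff_right)
qed

instance
proof
  fix a b c :: "'a free_lie" and r s :: real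
  show "lie a a = 0"
    by transfer (simp add: lie_ideal.self)
  show "lie a (lie b c) + lie b (lie c a) + lie c (lie a b) = 0"
    by transfer (simp add: lie_ideal.jacobi)
qed (transfer; simp add: lie_ideal.zero algebra_simps mmul_add_left mmul_add_right
       mmul_scale_left mmul_scale_right)+

end

lift_definition free_gen :: "'a \<Rightarrow> 'a free_lie" is "\<lambda>i. Poly_Mapping.single (Gen i) 1" .

primrec magma_eval :: "('a \<Rightarrow> 'l::real_lie_algebra) \<Rightarrow> 'a magma \<Rightarrow> 'l" where
  "magma_eval x (Gen i) = x i"
| "magma_eval x (Br s t) = lie (magma_eval x s) (magma_eval x t)"

definition free_comp :: "nat \<Rightarrow> 'a free_lie set" where
  "free_comp i = span {magma_eval free_gen t | t. leaves t = i}"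

definition free_above :: "nat \<Rightarrow> 'a free_lie set" where
  "free_above d = span (\<Union>i\<in>{d<..}. free_comp i)"

lemma linear_abs_free_lie: "linear abs_free_lie"
  by (rule linearI) (simp_all add: plus_free_lie.abs_eq scaleR_free_lie.abs_eq)

lemma magma_eval_free_gen: "magma_eval free_gen t = abs_free_lie (Poly_Mapping.single t 1)"
  by (induction t) (simp_all add: free_gen.abs_eq lie_free_lie.abs_eq mmul_single)

lemma abs_free_lie_linext: "abs_free_lie f = linext (magma_eval free_gen) f"
  using linext_unique[OF linear_abs_free_lie, of f]
  by (simp only: magma_eval_free_gen[symmetric])

lemma span_free_eval: "span (range (magma_eval free_gen)) = (UNIV :: 'a free_lie set)"
proof -
  have "abs_free_lie f \<in> span (range (magma_eval free_gen))" for f :: "'a magma \<Rightarrow>\<^sub>0 real"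
    unfolding abs_free_lie_linext linext_def
    by (intro span_sum span_scale span_base) auto
  then show ?thesis
    by (metis Quotient_abs_rep[OF Quotient_free_lie] UNIV_eq_I)
qed

lemma free_above_alt:
  "free_above d = span {magma_eval free_gen t | t. d < leaves t}"
proof
  have "free_comp i \<subseteq> span {magma_eval free_gen t | t. d < leaves t}" if "d < i" for i
    unfolding free_comp_def using that by (intro span_mono) auto
  then show "free_above d \<subseteq> span {magma_eval free_gen t | t. d < leaves t}"
    unfolding free_above_def by (intro span_minimal) auto
  show "span {magma_eval free_gen t | t. d < leaves t} \<subseteq> free_above d"
    unfolding free_above_def free_comp_def
    by (intro span_mono) (auto intro: span_base)
qed

lemma lie_free_above:
  assumes "b \<in> free_above d"
  shows "lie a b \<in> free_above d"
proof -
  have *: "lie (magma_eval free_gen s) b \<in> free_above d" for s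
    using assms unfolding free_above_alt
  proof (induction rule: span_induct_alt)
    case (step c x y)
    then obtain t where "x = magma_eval free_gen t" "d < leaves t" by auto
    then have "lie (magma_eval free_gen s) x \<in> span {magma_eval free_gen t | t. d < leaves t}"
      by (intro span_base) (auto intro!: exI[of _ "Br s t"])
    with step show ?case
      by (simp add: lie_add_right lie_scale_right span_add span_scale)
  qed (simp add: span_zero)
  have "a \<in> span (range (magma_eval free_gen))"
    by (simp add: span_free_eval)
  then show ?thesis
  proof (induction rule: span_induct_alt)
    case (step c x y)
    then show ?case using * unfolding free_above_def
      by (auto simp: lie_add_left lie_scale_left intro: span_add span_scale)
  qed (simp add: free_above_def span_zero)
qed

lemma lie_free_above': "a \<in> free_above d \<Longrightarrow> lie a b \<in> free_above d"
  by (metis (no_types) free_above_def lie_anticomm lie_free_above span_neg)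

text \<open>The class is the cardinality of the phantom type parameter \<open>'d\<close>, in the same way as the
  length of a machine word is given by its type. It is meaningful for finite \<open>'d\<close> only, and every
  positive class arises.\<close>

quotient_type ('a, 'd) nilp_lie = "'a free_lie" / "\<lambda>a b. a - b \<in> free_above CARD('d)"
proof (rule equivpI)
  show "reflp (\<lambda>a b :: 'a free_lie. a - b \<in> free_above CARD('d))"
    by (simp add: reflp_def free_above_def span_zero)
  show "symp (\<lambda>a b :: 'a free_lie. a - b \<in> free_above CARD('d))"
    by (metis (lifting) free_above_def span_neg minus_diff_eq sympI)
  show "transp (\<lambda>a b :: 'a free_lie. a - b \<in> free_above CARD('d))"
    unfolding free_above_def by (rule transpI) (drule (1) span_add, simp)
qed

instantiation nilp_lie :: (type, type) real_lie_algebra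
begin

lift_definition zero_nilp_lie :: "('a, 'b) nilp_lie" is 0 .

lift_definition plus_nilp_lie :: "('a, 'b) nilp_lie \<Rightarrow> ('a, 'b) nilp_lie \<Rightarrow> ('a, 'b) nilp_lie"
  is "(+)"
  by (metis add_diff_add free_above_def span_add)

lift_definition uminus_nilp_lie :: "('a, 'b) nilp_lie \<Rightarrow> ('a, 'b) nilp_lie" is uminus
  by (metis free_above_def span_neg minus_diff_minus)

lift_definition minus_nilp_lie :: "('a, 'b) nilp_lie \<Rightarrow> ('a, 'b) nilp_lie \<Rightarrow> ('a, 'b) nilp_lie"
  is "(-)"
proof -
  fix f f' g g' :: "'a free_lie"
  assume "f - f' \<in> free_above CARD('b)" "g - g' \<in> free_above CARD('b)"
  then have "(f - f') - (g - g') \<in> free_above CARD('b)"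
    unfolding free_above_def by (rule span_diff)
  then show "f - g - (f' - g') \<in> free_above CARD('b)"
    by (simp add: algebra_simps)
qed

lift_definition scaleR_nilp_lie :: "real \<Rightarrow> ('a, 'b) nilp_lie \<Rightarrow> ('a, 'b) nilp_lie" is "(*\<^sub>R)"
  by (metis free_above_def span_scale scaleR_diff_right)

lift_definition lie_nilp_lie :: "('a, 'b) nilp_lie \<Rightarrow> ('a, 'b) nilp_lie \<Rightarrow> ('a, 'b) nilp_lie"
  is lie
proof -
  fix f f' g g' :: "'a free_lie"
  assume "f - f' \<in> free_above CARD('b)" "g - g' \<in> free_above CARD('b)"
  then have "lie (f - f') g + lie f' (g - g') \<in> free_above CARD('b)"
    using lie_free_above lie_free_above' span_add unfolding free_above_def by metis
  then show "lie f g - lie f' g' \<in> free_above CARD('b)"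
    by (simp add: lie_diff_left lie_diff_right)
qed

instance
proof
  fix a b c :: "('a, 'b) nilp_lie"
  show "lie a (lie b c) + lie b (lie c a) + lie c (lie a b) = 0"
    by transfer (simp add: lie_jacobi free_above_def span_zero)
qed (transfer; simp add: free_above_def span_zero algebra_simps lie_add_left lie_add_right
       lie_scale_left lie_scale_right lie_self)+

end

definition gen :: "'a \<Rightarrow> ('a, 'd) nilp_lie" where
  "gen i = abs_nilp_lie (free_gen i)"

definition nilp_comp :: "nat \<Rightarrow> ('a, 'd) nilp_lie set" where
  "nilp_comp i = abs_nilp_lie ` free_comp i"

typedef (overloaded) 'l deriv =
  "{D :: 'l::real_lie_algebra \<Rightarrow> 'l. linear D \<and> (\<forall>a b. D (lie a b) = lie (D a) b + lie a (D b))}"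
  morphisms apply_deriv Deriv
  by (rule exI[of _ "\<lambda>_. 0"]) (simp add: linear_zero)

setup_lifting type_definition_deriv

instantiation deriv :: (real_lie_algebra) real_lie_algebra
begin

lift_definition zero_deriv :: "'a deriv" is "\<lambda>_. 0"
  by (simp add: linear_zero)

lift_definition plus_deriv :: "'a deriv \<Rightarrow> 'a deriv \<Rightarrow> 'a deriv" is "\<lambda>D E a. D a + E a"
  by (auto simp: linear_compose_add lie_add_left lie_add_right)

lift_definition uminus_deriv :: "'a deriv \<Rightarrow> 'a deriv" is "\<lambda>D a. - D a"
  by (auto simp: linear_compose_neg lie_minus_left lie_minus_right)

lift_definition minus_deriv :: "'a deriv \<Rightarrow> 'a deriv \<Rightarrow> 'a deriv" is "\<lambda>D E a. D a - E a"
  by (auto simp: linear_compose_sub lie_diff_left lie_diff_right)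

lift_definition scaleR_deriv :: "real \<Rightarrow> 'a deriv \<Rightarrow> 'a deriv" is "\<lambda>r D a. r *\<^sub>R D a"
  by (auto simp: linear_compose_scale_right lie_scale_left lie_scale_right scaleR_right_distrib)

lift_definition lie_deriv :: "'a deriv \<Rightarrow> 'a deriv \<Rightarrow> 'a deriv" is "\<lambda>D E a. D (E a) - E (D a)"
proof (safe, goal_cases)
  case (1 D E)
  then show ?case
    using linear_compose_sub[OF linear_compose[of E D] linear_compose[of D E]]
    by (simp add: o_def)
next
  case (2 D E a b)
  then show ?case
    by (simp add: linear_add lie_diff_left lie_diff_right)
qed

instance
  by standard (transfer; auto simp: fun_eq_iff algebra_simps linear_add linear_diff linear_scale)+

end

lemma linear_apply_deriv: "linear (apply_deriv D)"
  and apply_deriv_lie: "apply_deriv D (lie a b) = lie (apply_deriv D a) b + lie a (apply_deriv D b)"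
  by (transfer, simp)+

lemma linear_abs_nilp_lie: "linear (abs_nilp_lie :: _ \<Rightarrow> ('a, 'd) nilp_lie)"
  by (rule linearI) (simp_all add: plus_nilp_lie.abs_eq scaleR_nilp_lie.abs_eq)

lemma abs_nilp_lie_eval: "abs_nilp_lie (magma_eval free_gen t) = magma_eval gen t"
  by (induction t) (simp_all add: gen_def lie_nilp_lie.abs_eq[symmetric])

lemma abs_nilp_lie_linext: "abs_nilp_lie (abs_free_lie f) = linext (magma_eval gen) f"
  by (simp add: abs_free_lie_linext linext_def linear_sum[OF linear_abs_nilp_lie]
      linear_scale[OF linear_abs_nilp_lie] abs_nilp_lie_eval)

lemma span_nilp_eval: "span (range (magma_eval gen)) = (UNIV :: ('a, 'd) nilp_lie set)"
proof -
  have "range (abs_nilp_lie :: _ \<Rightarrow> ('a, 'd) nilp_lie) = UNIV"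
    by (metis Quotient_abs_rep[OF Quotient_nilp_lie] surj_def)
  moreover have "range (magma_eval gen :: _ \<Rightarrow> ('a, 'd) nilp_lie) =
      abs_nilp_lie ` range (magma_eval free_gen)"
    by (simp add: image_image abs_nilp_lie_eval)
  ultimately show ?thesis
    by (simp only: linear_span_image[OF linear_abs_nilp_lie] span_free_eval)
qed

lemma nilp_eval_eq_0: "CARD('d) < leaves t \<Longrightarrow> magma_eval gen t = (0 :: ('a, 'd) nilp_lie)"
  unfolding abs_nilp_lie_eval[symmetric] zero_nilp_lie_def nilp_lie.abs_eq_iff free_above_alt
  by (auto intro: span_base)

lemma deriv_eqI:
  fixes D E :: "('a, 'd) nilp_lie deriv"
  assumes "\<And>j. apply_deriv D (gen j) = apply_deriv E (gen j)"
  shows "D = E"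
proof -
  have *: "apply_deriv D (magma_eval gen t) = apply_deriv E (magma_eval gen t)" for t
    by (induction t) (simp_all add: assms apply_deriv_lie)
  have "apply_deriv D a = apply_deriv E a" for a
    using linear_eq_on[OF linear_apply_deriv linear_apply_deriv, of a "range (magma_eval gen)" D E] *
    by (auto simp: span_nilp_eval)
  then show ?thesis
    by (simp add: apply_deriv_inject[symmetric] fun_eq_iff)
qed

primrec leibniz :: "('a \<Rightarrow> 'l::real_lie_algebra) \<Rightarrow> ('a \<Rightarrow> 'l) \<Rightarrow> 'a magma \<Rightarrow> 'l" where
  "leibniz x f (Gen i) = f i"
| "leibniz x f (Br s t) =
     lie (leibniz x f s) (magma_eval x t) + lie (magma_eval x s) (leibniz x f t)"

lemma bilinear_ext:
  assumes "\<And>s. linear (\<lambda>g. B (Poly_Mapping.single s 1) g)"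
    and "\<And>g. linear (\<lambda>f. B f g)" "\<And>s. linear (\<lambda>g. C (Poly_Mapping.single s 1) g)"
    and "\<And>g. linear (\<lambda>f. C f g)"
    and "\<And>s t. B (Poly_Mapping.single s 1) (Poly_Mapping.single t 1) =
               C (Poly_Mapping.single s 1) (Poly_Mapping.single t 1)"
  shows "B (f :: 'm \<Rightarrow>\<^sub>0 real) (g :: 'm \<Rightarrow>\<^sub>0 real) = C f g"
proof -
  have "B (Poly_Mapping.single s 1) g = C (Poly_Mapping.single s 1) g" for s
    by (subst linext_unique[OF assms(1)], subst linext_unique[OF assms(3)]) (simp only: assms(5))
  then show ?thesis
    by (subst linext_unique[OF assms(2)], subst linext_unique[OF assms(4)]) simp
qed

lemma linear_mmul_left: "linear (\<lambda>f. mmul f g)"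
  by (rule linearI) (simp_all add: mmul_add_left mmul_scale_left)

lemma linear_mmul_right: "linear (mmul f)"
  by (rule linearI) (simp_all add: mmul_add_right mmul_scale_right)

lemma linext_eval_mmul:
  "linext (magma_eval x) (mmul f g) = lie (linext (magma_eval x) f) (linext (magma_eval x) g)"
  by (rule bilinear_ext[where B = "\<lambda>f g. linext (magma_eval x) (mmul f g)"])
     (auto intro!: linearI simp: mmul_add_left mmul_add_right mmul_scale_left mmul_scale_right
        mmul_single linext_add linext_scale lie_add_left lie_add_right lie_scale_left lie_scale_right)

lemma linext_leibniz_mmul:
  "linext (leibniz x f) (mmul g h) =
     lie (linext (leibniz x f) g) (linext (magma_eval x) h) +
     lie (linext (magma_eval x) g) (linext (leibniz x f) h)"
  by (rule bilinear_ext[where B = "\<lambda>g h. linext (leibniz x f) (mmul g h)"])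
     (auto intro!: linearI simp: mmul_add_left mmul_add_right mmul_scale_left mmul_scale_right
        mmul_single linext_add linext_scale lie_add_left lie_add_right lie_scale_left lie_scale_right
        scaleR_right_distrib)

lemma linext_lie_ideal:
  assumes "g \<in> lie_ideal"
  shows "linext (magma_eval x) g = 0 \<and> linext (leibniz x f) g = 0"
  using assms
proof induction
  case (self g)
  then show ?case
    by (simp add: linext_eval_mmul linext_leibniz_mmul lie_self)
       (metis lie_anticomm add.right_inverse add.commute)
next
  case (jacobi g h k)
  let ?e = "linext (magma_eval x)" and ?d = "linext (leibniz x f)"
  have "?d (mmul g (mmul h k) + mmul h (mmul k g) + mmul k (mmul g h)) =
      (lie (?d g) (lie (?e h) (?e k)) + lie (?e h) (lie (?e k) (?d g)) + lie (?e k) (lie (?d g) (?e h))) +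
      (lie (?e g) (lie (?d h) (?e k)) + lie (?d h) (lie (?e k) (?e g)) + lie (?e k) (lie (?e g) (?d h))) +
      (lie (?e g) (lie (?e h) (?d k)) + lie (?e h) (lie (?d k) (?e g)) + lie (?d k) (lie (?e g) (?e h)))"
    by (simp add: linext_add linext_eval_mmul linext_leibniz_mmul lie_add_right algebra_simps)
  then show ?case
    by (simp add: linext_add linext_eval_mmul lie_jacobi)
qed (auto simp: linext_add linext_scale linext_zero linext_eval_mmul linext_leibniz_mmul)

definition nilp_from :: "nat \<Rightarrow> ('a, 'd) nilp_lie set" where
  "nilp_from k = span {magma_eval gen t | t. k \<le> leaves t}"

lemma lie_nilp_from:
  assumes "a \<in> nilp_from i" "b \<in> nilp_from j"
  shows "lie a b \<in> nilp_from (i + j)"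
proof -
  have *: "lie (magma_eval gen s) b \<in> nilp_from (i + j)" if "i \<le> leaves s" for s
    using assms(2) unfolding nilp_from_def
  proof (induction rule: span_induct_alt)
    case (step c x y)
    then obtain t where "x = magma_eval gen t" "j \<le> leaves t" by auto
    with that have "lie (magma_eval gen s) x \<in> span {magma_eval gen t | t. i + j \<le> leaves t}"
      by (intro span_base) (auto intro!: exI[of _ "Br s t"])
    with step show ?case
      by (simp add: lie_add_right lie_scale_right span_add span_scale)
  qed (simp add: span_zero)
  show ?thesis
    using assms(1) unfolding nilp_from_def
  proof (induction rule: span_induct_alt)
    case (step c x y)
    then show ?case using * unfolding nilp_from_def
      by (auto simp: lie_add_left lie_scale_left intro!: span_add span_scale)
  qed (simp add: span_zero)
qed

lemma nilp_from_eq_0: "a \<in> nilp_from k \<Longrightarrow> CARD('d) < k \<Longrightarrow> a = (0 :: ('a, 'd) nilp_lie)"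
proof -
  assume "a \<in> nilp_from k" "CARD('d) < k"
  moreover from this have "{magma_eval gen t | t. k \<le> leaves t} \<subseteq> {0 :: ('a, 'd) nilp_lie}"
    by (auto intro!: nilp_eval_eq_0)
  ultimately have "a \<in> span {0}"
    unfolding nilp_from_def using span_mono by blast
  then show "a = 0"
    by simp
qed

lemma leibniz_nilp_from:
  "leibniz gen f t \<in> (nilp_from (leaves t) :: ('a, 'd) nilp_lie set)"
proof (induction t)
  case (Gen i)
  have "{magma_eval gen t | t. leaves (Gen i) \<le> leaves t} =
      range (magma_eval gen :: _ \<Rightarrow> ('a, 'd) nilp_lie)"
    using leaves_pos by auto
  then have "nilp_from (leaves (Gen i)) = (UNIV :: ('a, 'd) nilp_lie set)"
    unfolding nilp_from_def by (simp only: span_nilp_eval)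
  then show ?case by simp
next
  case (Br s t)
  have "magma_eval gen t \<in> (nilp_from (leaves t) :: ('a, 'd) nilp_lie set)" for t :: "'a magma"
    unfolding nilp_from_def by (intro span_base) auto
  with Br have "lie (leibniz gen f s) (magma_eval gen t) \<in> nilp_from (leaves s + leaves t)"
    "lie (magma_eval gen s) (leibniz gen f t) \<in> nilp_from (leaves s + leaves t)"
    by (intro lie_nilp_from; simp)+
  then show ?case
    unfolding leibniz.simps leaves.simps nilp_from_def by (rule span_add)
qed

lemma deriv_exists: "\<exists>D :: ('a, 'd) nilp_lie deriv. \<forall>j. apply_deriv D (gen j) = f j"
proof -
  let ?d = "linext (leibniz gen f)" and ?e = "linext (magma_eval (gen :: 'a \<Rightarrow> ('a, 'd) nilp_lie))"
  have surj: "\<exists>g. a = ?e g" for a :: "('a, 'd) nilp_lie"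
    by (metis abs_nilp_lie_linext Quotient_abs_rep[OF Quotient_nilp_lie]
        Quotient_abs_rep[OF Quotient_free_lie])
  have above: "\<exists>k. b = abs_free_lie k \<and> ?d k = 0" if "b \<in> free_above CARD('d)" for b
    using that unfolding free_above_alt
  proof (induction rule: span_induct_alt)
    case base
    show ?case by (intro exI[of _ 0]) (simp add: linext_zero zero_free_lie.abs_eq)
  next
    case (step c x y)
    then obtain t k where "x = magma_eval free_gen t" "CARD('d) < leaves t"
      "y = abs_free_lie k" "?d k = 0" by auto
    then show ?case
      using nilp_from_eq_0[OF leibniz_nilp_from[of f t]]
      by (intro exI[of _ "c *\<^sub>R Poly_Mapping.single t 1 + k"])
         (simp add: magma_eval_free_gen linext_add linext_scale
            plus_free_lie.abs_eq scaleR_free_lie.abs_eq)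
  qed
  have ker: "?d g = 0" if "?e g = 0" for g
  proof -
    from that have "abs_free_lie g \<in> free_above CARD('d)"
      unfolding abs_nilp_lie_linext[symmetric] zero_nilp_lie_def nilp_lie.abs_eq_iff by simp
    from above[OF this] obtain k where "abs_free_lie g = abs_free_lie k" "?d k = 0" by auto
    then have "g - k \<in> lie_ideal" "?d k = 0"
      by (simp_all add: free_lie.abs_eq_iff)
    with linext_lie_ideal[of "g - k" gen f] show ?thesis
      by (simp add: linear_diff[OF linear_linext])
  qed
  define r where "r a = (SOME g. a = ?e g)" for a
  have r: "?e (r a) = a" for a
    unfolding r_def using someI_ex[OF surj[of a]] by simp
  have d: "?d (r (?e g)) = ?d g" for g
    using ker[of "r (?e g) - g"] by (simp add: linear_diff[OF linear_linext] r)
  define D where "D a = ?d (r a)" for a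
  have "linear D"
  proof (rule linearI)
    fix a b c
    show "D (a + b) = D a + D b"
      unfolding D_def using d[of "r a + r b"] by (simp add: linext_add r)
    show "D (c *\<^sub>R a) = c *\<^sub>R D a"
      unfolding D_def using d[of "c *\<^sub>R r a"] by (simp add: linext_scale r)
  qed
  moreover have "D (lie a b) = lie (D a) b + lie a (D b)" for a b
    unfolding D_def using d[of "mmul (r a) (r b)"]
    by (simp add: linext_eval_mmul linext_leibniz_mmul r)
  ultimately have "apply_deriv (Deriv D) = D"
    by (intro Deriv_inverse) simp
  moreover have "D (gen j) = f j" for j
    unfolding D_def using d[of "Poly_Mapping.single (Gen j) 1"] by simp
  ultimately show ?thesis by metis
qed

definition der_comp :: "nat \<Rightarrow> ('a, 'd) nilp_lie deriv set" where
  "der_comp k = {D. \<forall>i. apply_deriv D ` nilp_comp i \<subseteq> nilp_comp (i + k)}"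

definition UL :: "('a, 'd) nilp_lie deriv set" where
  "UL = span (\<Union>k\<in>{1..<CARD('d)}. der_comp k)"

text \<open>A derivation of degree 0 acts on the span of the generators by the matrix \<open>A\<close>, whose
  column \<open>j\<close> holds the coordinates of the image of generator \<open>j\<close>.\<close>

definition sl :: "('n::finite, 'd) nilp_lie deriv set" where
  "sl = {D \<in> der_comp 0. \<exists>A :: real^'n^'n. trace A = 0 \<and>
           (\<forall>j. apply_deriv D (gen j) = (\<Sum>i\<in>UNIV. A $ i $ j *\<^sub>R gen i))}"

definition sl_invariant :: "('n::finite, 'd) nilp_lie deriv set \<Rightarrow> bool" where
  "sl_invariant S \<longleftrightarrow> (\<forall>T\<in>sl. \<forall>D\<in>S. lie T D \<in> S)"

definition sl_lie_generated ::
    "('n::finite, 'd) nilp_lie deriv set \<Rightarrow> ('n, 'd) nilp_lie deriv set" where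
  "sl_lie_generated G = (\<lambda>S. lie_subalgebra S \<and> sl_invariant S) hull G"

text \<open>\<open>f\<close> lists the values on the generators; the extension exists and is unique for every \<open>f\<close>
  (lemma \<open>extend_deriv_gen\<close>, with \<open>deriv_exists\<close> and \<open>deriv_eqI\<close>).\<close>

definition extend_deriv :: "('a \<Rightarrow> ('a, 'd) nilp_lie) \<Rightarrow> ('a, 'd) nilp_lie deriv" where
  "extend_deriv f = (THE D. \<forall>j. apply_deriv D (gen j) = f j)"

lemma extend_deriv_gen [simp]: "apply_deriv (extend_deriv f) (gen j) = f j"
proof -
  have "\<exists>!D. \<forall>j. apply_deriv D (gen j) = f j"
    using deriv_exists[of f] deriv_eqI by (metis (no_types, lifting))
  from theI'[OF this] show ?thesis
    unfolding extend_deriv_def by blast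
qed

definition AD :: "'a \<Rightarrow> nat \<Rightarrow> ('a, 'd) nilp_lie deriv" where
  "AD i k = extend_deriv (\<lambda>j. (lie (gen i) ^^ k) (gen j))"

definition Delta :: "'a \<Rightarrow> ('a, 'd) nilp_lie \<Rightarrow> ('a, 'd) nilp_lie deriv" where
  "Delta i a = extend_deriv (\<lambda>j. if j = i then a else 0)"

end

theory Submission
  imports Defs
begin

text \<open>Let \<open>S\<close> be the generated algebra. By induction on the degree \<open>k\<close> one shows that \<open>S\<close> contains
  every derivation \<open>\<Delta>\<close> sending one generator \<open>z\<close> to a Lie word \<open>w\<close> of length \<open>k + 1\<close> and killing
  the others. If \<open>z\<close> does not occur in \<open>w\<close>, then \<open>\<Delta>\<close> is a bracket of derivations of lower degree.
  Otherwise write \<open>w\<close> as a bracket of elements \<open>ad m\<^sub>j z\<close> with \<open>m\<^sub>j\<close> free of \<open>z\<close>. When at most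
  \<open>n - 1\<close> of the \<open>m\<^sub>j\<close> are nonempty, the derivations of the subalgebra generated by the letters other
  than \<open>z\<close> reduce everything to \<open>m\<^sub>j = x\<^sub>j\<^sup>r\<close> with distinct letters \<open>x\<^sub>j\<close>. A single occurrence of
  \<open>z\<close> is then supplied by \<open>AD\<close>, and several occurrences are reduced to a single one by exchanging
  \<open>z\<close> for a letter that is spare, or for some \<open>x\<^sub>j\<close> when there is none.

  Finally, if \<open>z\<close> occurs at least \<open>n\<close> times in \<open>w\<close>, then \<open>k + 1 \<le> n (n - 1)\<close> leaves a letter that
  occurs at most \<open>n - 2\<close> times, and moving \<open>z\<close> to this letter reduces to the previous case.\<close>

subsection \<open>Right-normed words\<close>

lemma lie_lie_left: "lie (lie a b) c = lie a (lie b c) - lie b (lie a c)"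
  for a b c :: "'l::real_lie_algebra"
  using lie_jacobi[of a b c] lie_anticomm[of c a] lie_anticomm[of c "lie a b"]
  by (simp add: lie_minus_right algebra_simps)

text \<open>The empty bracket defaults to 0, which lies in every subspace, so the statements by
  length also hold for the empty word.\<close>

fun right_bracket :: "'l::real_lie_algebra list \<Rightarrow> 'l" where
  "right_bracket [] = 0"
| "right_bracket [a] = a"
| "right_bracket (a # b # as) = lie a (right_bracket (b # as))"

lemma right_bracket_Cons: "as \<noteq> [] \<Longrightarrow> right_bracket (a # as) = lie a (right_bracket as)"
  by (cases as) auto

lemma linear_right_bracket: "linear (\<lambda>y. right_bracket (as @ y # bs))"
proof (induction as)
  case Nil
  show ?case
    by (cases bs) (simp_all add: linear_lie_left linear_ident)
next
  case (Cons a as)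
  have "linear (\<lambda>y. lie a (right_bracket (as @ y # bs)))"
    using linear_compose[OF Cons linear_lie_right[of a]] by (simp add: o_def)
  then show ?case
    by (simp add: right_bracket_Cons)
qed

lemma linear_right_bracket_update:
  "i < length as \<Longrightarrow> linear (\<lambda>y. right_bracket (as[i := y]))"
  by (simp add: upd_conv_take_nth_drop linear_right_bracket)

lemma deriv_right_bracket:
  "apply_deriv D (right_bracket as) = (\<Sum>i<length as. right_bracket (as[i := apply_deriv D (as ! i)]))"
proof (induction as rule: right_bracket.induct)
  case (3 a b as)
  let ?bs = "b # as"
  have "(\<Sum>i<length (a # ?bs). right_bracket ((a # ?bs)[i := apply_deriv D ((a # ?bs) ! i)])) =
      lie (apply_deriv D a) (right_bracket ?bs) +
      (\<Sum>i<length ?bs. right_bracket (a # ?bs[i := apply_deriv D (?bs ! i)]))"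
    by (simp only: length_Cons[of a] sum.lessThan_Suc_shift) simp
  also have "(\<Sum>i<length ?bs. right_bracket (a # ?bs[i := apply_deriv D (?bs ! i)])) =
      lie a (\<Sum>i<length ?bs. right_bracket (?bs[i := apply_deriv D (?bs ! i)]))"
    unfolding linear_sum[OF linear_lie_right]
    by (intro sum.cong refl right_bracket_Cons) (auto simp del: list_update.simps simp flip: length_greater_0_conv)
  finally show ?case
    using 3 by (simp add: apply_deriv_lie)
qed (auto simp: linear_0[OF linear_apply_deriv])

abbreviation word :: "'a list \<Rightarrow> ('a, 'd) nilp_lie" where
  "word ws \<equiv> right_bracket (map gen ws)"

lemma word_Cons: "ws \<noteq> [] \<Longrightarrow> word (x # ws) = lie (gen x) (word ws)"
  by (simp add: right_bracket_Cons)

section \<open>Grading by length and by the number of occurrences of one letter\<close>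

definition words :: "'a \<Rightarrow> nat \<Rightarrow> nat \<Rightarrow> ('a, 'd) nilp_lie set" where
  "words z c l = span (word ` {ws. length ws = l \<and> count_list ws z = c})"

lemma word_in_words: "length ws = l \<Longrightarrow> count_list ws z = c \<Longrightarrow> word ws \<in> words z c l"
  unfolding words_def by (rule span_base) auto

lemma subspace_words: "subspace (words z c l)"
  unfolding words_def by simp

lemma words_subset:
  assumes "subspace A" "\<And>ws. length ws = l \<Longrightarrow> count_list ws z = c \<Longrightarrow> word ws \<in> A"
  shows "words z c l \<subseteq> A"
  unfolding words_def using assms by (intro span_minimal) auto

lemma words_subset_linear:
  assumes "linear T" "subspace A" "\<And>ws. length ws = l \<Longrightarrow> count_list ws z = c \<Longrightarrow> T (word ws) \<in> A"
    and "g \<in> words z c l"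
  shows "T g \<in> A"
  using words_subset[OF linear_subspace_vimage[OF assms(1,2)], of l z c] assms(3,4) by auto

lemma lie_gen_words:
  assumes "g \<in> words z c l"
  shows "lie (gen x) g \<in> words z (c + count_list [x] z) (Suc l)"
proof (rule words_subset_linear[OF linear_lie_right subspace_words _ assms])
  fix ws assume "length ws = l" "count_list ws z = c"
  then show "lie (gen x) (word ws) \<in> words z (c + count_list [x] z) (Suc l)"
    using subspace_0[OF subspace_words]
    by (cases "ws = []") (auto simp: word_Cons[symmetric] intro!: word_in_words simp del: list.map(2))
qed

text \<open>The first letter of the left word is split off by the Jacobi identity in the form
  \<open>lie_lie_left\<close>; both resulting terms bracket with a shorter left word.\<close>

lemma lie_word_words:
  assumes "g \<in> words z c l"
  shows "lie (word ws) g \<in> words z (count_list ws z + c) (length ws + l)"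
  using assms
proof (induction ws arbitrary: g c l)
  case Nil
  then show ?case by (simp add: subspace_0[OF subspace_words])
next
  case (Cons x ws)
  show ?case
  proof (cases "ws = []")
    case True
    with lie_gen_words[OF Cons.prems, of x] show ?thesis
      by (simp add: add.commute)
  next
    case False
    have "lie (word (x # ws)) g = lie (gen x) (lie (word ws) g) - lie (word ws) (lie (gen x) g)"
      by (simp add: word_Cons[OF False] lie_lie_left del: list.map)
    moreover have "lie (gen x) (lie (word ws) g) \<in> words z (count_list (x # ws) z + c) (length (x # ws) + l)"
      using lie_gen_words[OF Cons.IH[OF Cons.prems], of x] by (simp add: ac_simps split: if_splits)
    moreover have "lie (word ws) (lie (gen x) g) \<in> words z (count_list (x # ws) z + c) (length (x # ws) + l)"
      using Cons.IH[OF lie_gen_words[OF Cons.prems, of x]] by (simp add: ac_simps split: if_splits)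
    ultimately show ?thesis
      using subspace_diff[OF subspace_words] by metis
  qed
qed

lemma lie_words:
  assumes "a \<in> words z c l" "b \<in> words z c' l'"
  shows "lie a b \<in> words z (c + c') (l + l')"
  by (rule words_subset_linear[OF linear_lie_left subspace_words _ assms(1)])
     (use lie_word_words[OF assms(2)] in auto)

text \<open>Leibniz rule along a right-normed word. A letter has length 1, so values of length
  \<open>Suc q\<close> on the generators shift the degree by \<open>q\<close>.\<close>

lemma deriv_words:
  assumes "\<And>j. apply_deriv D (gen j) \<in> words z (count_list [j] z + p) (Suc q)"
    and "g \<in> words z c l"
  shows "apply_deriv D g \<in> words z (c + p) (l + q)"
proof -
  have "apply_deriv D (word ws) \<in> words z (count_list ws z + p) (length ws + q)" for ws
  proof (induction ws)
    case (Cons x ws)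
    show ?case
    proof (cases "ws = []")
      case True
      then show ?thesis using assms(1)[of x] by simp
    next
      case False
      have "lie (apply_deriv D (gen x)) (word ws) \<in>
          words z (count_list [x] z + p + count_list ws z) (Suc q + length ws)"
        by (intro lie_words assms(1) word_in_words refl)
      moreover have "lie (gen x) (apply_deriv D (word ws)) \<in>
          words z (count_list ws z + p + count_list [x] z) (Suc (length ws + q))"
        by (intro lie_gen_words Cons.IH)
      ultimately show ?thesis
        unfolding word_Cons[OF False] apply_deriv_lie
        by (intro subspace_add[OF subspace_words]) (simp_all add: ac_simps split: if_splits)
    qed
  qed (simp add: linear_0[OF linear_apply_deriv] subspace_0[OF subspace_words])
  then show ?thesis
    by (intro words_subset_linear[OF linear_apply_deriv subspace_words _ assms(2)]) auto
qed

lemma magma_eval_words: "\<exists>c. magma_eval gen t \<in> words z c (leaves t)"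
proof (induction t)
  case (Gen x)
  show ?case using word_in_words[of "[x]" 1 z] by auto
next
  case (Br s t)
  then show ?case using lie_words by fastforce
qed

lemma word_magma:
  "ws \<noteq> [] \<Longrightarrow> \<exists>t. leaves t = length ws \<and> word ws = (magma_eval gen t :: ('a, 'd) nilp_lie)"
proof (induction ws)
  case (Cons x ws)
  show ?case
  proof (cases "ws = []")
    case True
    then show ?thesis by (intro exI[of _ "Gen x"]) simp
  next
    case False
    with Cons.IH obtain t where "leaves t = length ws"
      "word ws = (magma_eval gen t :: ('a, 'd) nilp_lie)" by auto
    then show ?thesis
      by (intro exI[of _ "Br (Gen x) t"]) (simp add: word_Cons[OF False] del: list.map)
  qed
qed simp

section \<open>Homogeneous components in terms of right-normed words\<close>

lemma nilp_comp_magma: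
  "nilp_comp l = (span {magma_eval gen t | t. leaves t = l} :: ('a, 'd) nilp_lie set)"
proof -
  have "{magma_eval gen t | t. leaves t = l} =
      (abs_nilp_lie :: _ \<Rightarrow> ('a, 'd) nilp_lie) ` {magma_eval free_gen t | t. leaves t = l}"
    by (auto simp: abs_nilp_lie_eval[symmetric])
  then show ?thesis
    unfolding nilp_comp_def free_comp_def
    by (simp only: linear_span_image[OF linear_abs_nilp_lie])
qed

lemma subspace_nilp_comp: "subspace (nilp_comp l)"
  unfolding nilp_comp_magma by simp

lemma nilp_comp_words:
  "nilp_comp l = (span (word ` {ws. length ws = l}) :: ('a, 'd) nilp_lie set)"
proof
  show "nilp_comp l \<subseteq> (span (word ` {ws. length ws = l}) :: ('a, 'd) nilp_lie set)"
    unfolding nilp_comp_magma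
  proof (intro span_minimal subspace_span subsetI)
    fix a :: "('a, 'd) nilp_lie"
    assume "a \<in> {magma_eval gen t | t. leaves t = l}"
    then obtain t where t: "a = magma_eval gen t" "leaves t = l" by auto
    \<comment> \<open>The count is forgotten right away, so \<open>undefined\<close> serves as an
      arbitrary letter.\<close>
    then obtain c where "a \<in> words undefined c l"
      using magma_eval_words[of t undefined] by auto
    then show "a \<in> span (word ` {ws. length ws = l})"
      unfolding words_def by (rule subsetD[OF span_mono, rotated]) auto
  qed
  have "word ws \<in> (nilp_comp (length ws) :: ('a, 'd) nilp_lie set)" for ws
  proof (cases "ws = []")
    case False
    then obtain t where "leaves t = length ws" "word ws = (magma_eval gen t :: ('a, 'd) nilp_lie)"
      using word_magma by blast
    then show ?thesis
      unfolding nilp_comp_magma by (intro span_base) auto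
  qed (simp add: nilp_comp_magma span_zero)
  then show "span (word ` {ws. length ws = l}) \<subseteq> (nilp_comp l :: ('a, 'd) nilp_lie set)"
    by (intro span_minimal subspace_nilp_comp) auto
qed

lemma words_subset_nilp_comp: "words z c l \<subseteq> nilp_comp l"
  unfolding nilp_comp_words words_def by (rule span_mono) auto

lemma word_in_nilp_comp: "length ws = l \<Longrightarrow> word ws \<in> nilp_comp l"
  unfolding nilp_comp_words by (rule span_base) auto

lemma nilp_comp_eq_0: "g \<in> nilp_comp l \<Longrightarrow> CARD('d) < l \<Longrightarrow> g = (0 :: ('a, 'd) nilp_lie)"
  using nilp_from_eq_0[of g l] span_mono[of "{magma_eval gen t | t. leaves t = l}" "{magma_eval gen t | t. l \<le> leaves t}"]
  unfolding nilp_comp_magma nilp_from_def by auto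

lemma lie_nilp_comp:
  assumes "a \<in> nilp_comp i" "b \<in> nilp_comp j"
  shows "lie a b \<in> nilp_comp (i + j)"
proof -
  have *: "lie (word ws) b \<in> nilp_comp (length ws + j)" for ws
  proof -
    have "lie (word ws) (word vs) \<in> nilp_comp (length ws + length vs)" for vs
      by (rule subsetD[OF words_subset_nilp_comp lie_word_words[OF word_in_words[OF refl refl]]])
    then have "nilp_comp j \<subseteq> lie (word ws) -` nilp_comp (length ws + j)"
      unfolding nilp_comp_words[of j]
      by (intro span_minimal linear_subspace_vimage[OF linear_lie_right] subspace_nilp_comp) auto
    with assms(2) show ?thesis by auto
  qed
  have "nilp_comp i \<subseteq> (\<lambda>a. lie a b) -` nilp_comp (i + j)"
    unfolding nilp_comp_words[of i] using *
    by (intro span_minimal linear_subspace_vimage[OF linear_lie_left] subspace_nilp_comp) auto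
  with assms(1) show ?thesis by auto
qed

subsection \<open>Labels and polarisation\<close>

lemma apply_Delta_gen [simp]: "apply_deriv (Delta i a) (gen j) = (if j = i then a else 0)"
  by (simp add: Delta_def)

lemma linear_Delta: "linear (Delta i)"
  by (rule linearI; rule deriv_eqI) (simp_all add: plus_deriv.rep_eq scaleR_deriv.rep_eq)

lemma Delta_words_zero:
  assumes "g \<in> words z 0 l"
  shows "apply_deriv (Delta z w) g = 0"
proof -
  have "apply_deriv (Delta z w) (word ws) = 0" if "count_list ws z = 0" for ws
    using that
  proof (induction ws)
    case (Cons x ws)
    then show ?case
      by (cases "ws = []") (auto simp: right_bracket_Cons apply_deriv_lie split: if_splits)
  qed (simp add: linear_0[OF linear_apply_deriv])
  then have "apply_deriv (Delta z w) g \<in> {0}"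
    by (intro words_subset_linear[OF linear_apply_deriv _ _ assms]) auto
  then show ?thesis by simp
qed

text \<open>The other half of the commutator vanishes because \<open>Delta z w\<close> kills
  \<open>v\<close>, which is free of \<open>z\<close>. Bracketing with \<open>Delta a v\<close> thus
  acts on the value \<open>w\<close> alone.\<close>

lemma lie_Delta_free:
  assumes "a \<noteq> z" "v \<in> words z 0 l"
  shows "lie (Delta a v) (Delta z w) = Delta z (apply_deriv (Delta a v) w)"
  using assms Delta_words_zero[OF assms(2)]
  by (intro deriv_eqI) (auto simp: lie_deriv.rep_eq linear_0[OF linear_apply_deriv])

text \<open>A Lie word containing the letter \<open>z\<close> is a combination of right-normed brackets of elements
  \<open>ad g\<^sub>1 \<dots> ad g\<^sub>r z\<close> with factors \<open>g\<^sub>i\<close> free of \<open>z\<close> (Lazard elimination). A label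
  lists the factors of one such element, and a configuration lists the labels.\<close>

definition label :: "'a \<Rightarrow> 'a list list \<Rightarrow> ('a, 'd) nilp_lie" where
  "label z us = foldr (\<lambda>w. lie (word w)) us (gen z)"

definition config :: "'a \<Rightarrow> 'a list list list \<Rightarrow> ('a, 'd) nilp_lie" where
  "config z U = right_bracket (map (label z) U)"

text \<open>The degree of a label; \<open>Suc\<close> accounts for its final letter
  \<open>z\<close>.\<close>

definition weight :: "'a list list \<Rightarrow> nat" where
  "weight us = Suc (sum_list (map length us))"

text \<open>The factor at position \<open>i\<close> becomes an arbitrary Lie element instead of a
  word. This makes the label linear in \<open>g\<close>, as the Leibniz rule requires.\<close>

definition label_put :: "'a \<Rightarrow> 'a list list \<Rightarrow> nat \<Rightarrow> ('a, 'd) nilp_lie \<Rightarrow> ('a, 'd) nilp_lie" where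
  "label_put z us i g =
     foldr (\<lambda>w. lie (word w)) (take i us) (lie g (label z (drop (Suc i) us)))"

definition config_put ::
    "'a \<Rightarrow> 'a list list list \<Rightarrow> nat \<Rightarrow> nat \<Rightarrow> ('a, 'd) nilp_lie \<Rightarrow> ('a, 'd) nilp_lie" where
  "config_put z U j i g = right_bracket ((map (label z) U)[j := label_put z (U ! j) i g])"

lemma linear_foldr_lie: "linear (foldr (\<lambda>w. lie (h w)) us)"
proof (induction us)
  case Nil
  show ?case by (simp add: id_def linear_ident)
next
  case (Cons u us)
  show ?case
    using linear_compose[OF Cons linear_lie_right[of "h u"]] by (simp add: o_def)
qed

lemma linear_label_put: "linear (label_put z us i)"
  using linear_compose[OF linear_lie_left[of "label z (drop (Suc i) us)"]
      linear_foldr_lie[of word "take i us"]]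
  by (simp add: o_def label_put_def[abs_def])

lemma linear_config_put: "j < length U \<Longrightarrow> linear (config_put z U j i)"
  using linear_compose[OF linear_label_put[of z "U ! j" i] linear_right_bracket_update[of j "map (label z) U"]]
  by (simp add: o_def config_put_def[abs_def])

lemma label_put_word: "i < length us \<Longrightarrow> label_put z us i (word w) = label z (us[i := w])"
  by (simp add: label_put_def label_def upd_conv_take_nth_drop)

lemma config_put_word:
  "j < length U \<Longrightarrow> i < length (U ! j) \<Longrightarrow>
     config_put z U j i (word w) = config z (U[j := (U ! j)[i := w]])"
  by (simp add: config_put_def config_def label_put_word map_update)

lemma deriv_label:
  fixes D :: "('a, 'd) nilp_lie deriv"
  assumes "apply_deriv D (gen z) = 0"
  shows "apply_deriv D (label z us) = (\<Sum>i<length us. label_put z us i (apply_deriv D (word (us ! i))))"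
proof (induction us)
  case Nil
  then show ?case using assms by (simp add: label_def)
next
  case (Cons u us)
  have "label z (u # us) = lie (word u) (label z us :: ('a, 'd) nilp_lie)"
    by (simp add: label_def)
  moreover have "label_put z (u # us) (Suc i) g = lie (word u) (label_put z us i g)"
    for i and g :: "('a, 'd) nilp_lie"
    by (simp add: label_put_def)
  ultimately show ?case
    using Cons
    by (simp add: apply_deriv_lie sum.lessThan_Suc_shift linear_sum[OF linear_lie_right]
        label_put_def[of _ _ 0] del: sum.lessThan_Suc)
qed

text \<open>As \<open>D\<close> kills \<open>z\<close>, only the factors are differentiated, one
  pair (label, position) at a time.\<close>

lemma deriv_config:
  assumes "apply_deriv D (gen z) = 0"
  shows "apply_deriv D (config z U) =
    (\<Sum>(j, i)\<in>(SIGMA j:{..<length U}. {..<length (U ! j)}). config_put z U j i (apply_deriv D (word (U ! j ! i))))"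
  unfolding config_def deriv_right_bracket[of D "map (label z) U"]
  by (subst sum.Sigma[symmetric])
     (auto simp: deriv_label[OF assms] config_put_def
       linear_sum[OF linear_right_bracket_update[of _ "map (label z) U"]]
       simp del: deriv_right_bracket intro!: sum.cong)

lemma label_words:
  assumes "\<forall>w\<in>set us. z \<notin> set w"
  shows "label z us \<in> (words z 1 (weight us) :: ('a, 'd) nilp_lie set)"
  using assms
proof (induction us)
  case Nil
  show ?case using word_in_words[of "[z]" 1 z 1] by (simp add: label_def weight_def)
next
  case (Cons u us)
  then have "lie (word u) (label z us) \<in>
      (words z (0 + 1) (length u + weight us) :: ('a, 'd) nilp_lie set)"
    by (intro lie_words word_in_words) auto
  then show ?case by (simp add: label_def weight_def)
qed

lemma config_words:
  assumes "\<forall>us\<in>set U. \<forall>w\<in>set us. z \<notin> set w"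
  shows "config z U \<in> (words z (length U) (sum_list (map weight U)) :: ('a, 'd) nilp_lie set)"
  using assms
proof (induction U)
  case Nil
  show ?case using subspace_0[OF subspace_words] by (simp add: config_def)
next
  case (Cons us U)
  show ?case
  proof (cases "U = []")
    case True
    with Cons.prems label_words[of us z] show ?thesis by (simp add: config_def)
  next
    case False
    then have "config z (us # U) = lie (label z us) (config z U :: ('a, 'd) nilp_lie)"
      by (simp add: config_def right_bracket_Cons)
    with Cons lie_words[OF label_words[of us z] Cons.IH] show ?thesis by simp
  qed
qed

lemma sum_list_map_update:
  fixes g :: "'a \<Rightarrow> nat"
  assumes "j < length U"
  shows "sum_list (map g (U[j := a])) + g b = sum_list (map g (U[j := b])) + g a"
  using assms by (simp add: upd_conv_take_nth_drop)

lemma sum_list_map_update_same: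
  fixes g :: "'a \<Rightarrow> nat"
  assumes "j < length U"
  shows "sum_list (map g (U[j := a])) + g (U ! j) = sum_list (map g U) + g a"
  using sum_list_map_update[OF assms, of g a "U ! j"] by simp

text \<open>Label \<open>j\<close> owns the letter \<open>f j\<close>. A subspace \<open>A\<close> that is stable under moving letters other than
  \<open>z\<close> contains every configuration as soon as it contains those in which all factors of label \<open>j\<close>
  equal \<open>f j\<close>. Modulo configurations with fewer factors the factors of a label commute, and a factor
  \<open>v \<noteq> f j\<close> arises by applying the derivation \<open>f j \<mapsto> v\<close> to the configuration with \<open>v\<close>
  replaced by \<open>f j\<close>. The letters \<open>f j\<close> must be distinct, which is why the number of nonempty
  labels has to be bounded in terms of the number of generators.\<close>

locale polarisation =
  fixes z :: "'n" and f :: "nat \<Rightarrow> 'n" and J :: "nat set"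
    and A :: "('n, 'd) nilp_lie set" and N K :: nat
  assumes inj: "inj_on f J" and f_z: "j \<in> J \<Longrightarrow> f j \<noteq> z" and A: "subspace A"
    and act_gen: "\<And>a b g. a \<noteq> z \<Longrightarrow> b \<noteq> z \<Longrightarrow> b \<noteq> a \<Longrightarrow> g \<in> A \<Longrightarrow> apply_deriv (Delta a (gen b)) g \<in> A"
    and act_word: "\<And>a v g l. a \<noteq> z \<Longrightarrow> z \<notin> set v \<Longrightarrow> 2 \<le> length v \<Longrightarrow> 2 \<le> l \<Longrightarrow>
      l + length v = Suc K \<Longrightarrow> g \<in> words z N l \<Longrightarrow> apply_deriv (Delta a (word v)) g \<in> A"
begin

text \<open>Labels with index outside \<open>J\<close> are empty, so only nonempty labels have to
  own a letter.\<close>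

definition good :: "'n list list list \<Rightarrow> bool" where
  "good U \<longleftrightarrow> length U = N \<and> sum_list (map weight U) = K \<and>
     (\<forall>us\<in>set U. \<forall>w\<in>set us. w \<noteq> [] \<and> z \<notin> set w) \<and> (\<forall>j<N. U ! j \<noteq> [] \<longrightarrow> j \<in> J)"

text \<open>Outer induction measure of \<open>config_in\<close>; it drops when a commutator merges
  two factors into one.\<close>

definition factors :: "'n list list list \<Rightarrow> nat" where
  "factors U = sum_list (map length U)"

text \<open>Inner induction measure of \<open>config_in\<close>; it is zero exactly when every
  factor is the letter owned by its label.\<close>

definition defect :: "'n list list list \<Rightarrow> nat" where
  "defect U = (\<Sum>j<length U. length (filter (\<lambda>w. w \<noteq> [f j]) (U ! j)))"

lemma good_update:
  assumes "good U" "j < N" "us = [] \<longleftrightarrow> U ! j = []" "weight us = weight (U ! j)"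
    and "\<forall>w\<in>set us. w \<noteq> [] \<and> z \<notin> set w"
  shows "good (U[j := us])"
  using assms sum_list_map_update_same[of j U weight us]
  unfolding good_def by (auto simp: nth_list_update dest!: set_update_subset_insert[THEN subsetD])

lemma defect_update:
  assumes "j < length U"
  shows "defect (U[j := us]) + length (filter (\<lambda>w. w \<noteq> [f j]) (U ! j)) =
    defect U + length (filter (\<lambda>w. w \<noteq> [f j]) us)"
proof -
  have "defect V = (\<Sum>i\<in>{..<length U} - {j}. length (filter (\<lambda>w. w \<noteq> [f i]) (V ! i))) +
      length (filter (\<lambda>w. w \<noteq> [f j]) (V ! j))" if "length V = length U" for V
    using assms that unfolding defect_def by (simp add: sum.remove[of _ j])
  from this[of U] this[of "U[j := us]"] show ?thesis
    using assms by simp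
qed

text \<open>By Jacobi the difference is the configuration with the single factor
  \<open>[a,b]\<close> in place of the two. Expanding \<open>[a,b]\<close> into words gives
  configurations with one factor less.\<close>

lemma adjacent_swap:
  assumes U: "good U" "j < N" "U ! j = p @ a # b # q"
    and smaller: "\<And>V. good V \<Longrightarrow> factors V < factors U \<Longrightarrow> config z V \<in> A"
  shows "config z U - config z (U[j := p @ b # a # q]) \<in> A"
proof -
  have j: "j < length U" and ab: "a \<noteq> []" "b \<noteq> []" "z \<notin> set a" "z \<notin> set b"
    using U nth_mem[of j U] by (auto simp: good_def)
  define T :: "('n, 'd) nilp_lie \<Rightarrow> ('n, 'd) nilp_lie" where "T = config_put z (U[j := p @ a # q]) j (length p)"
  have "label z (p @ a # b # q) - label z (p @ b # a # q) =
      (label_put z (p @ a # q) (length p) (lie (word a) (word b)) :: ('n, 'd) nilp_lie)"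
  proof -
    have "label z (a # b # q) - label z (b # a # q) =
        lie (lie (word a) (word b)) (label z q :: ('n, 'd) nilp_lie)"
      by (simp add: label_def lie_lie_left)
    then show ?thesis
      by (simp add: label_def label_put_def linear_diff[OF linear_foldr_lie, symmetric])
  qed
  then have "T (lie (word a) (word b)) =
      right_bracket ((map (label z) U)[j := label z (p @ a # b # q) - label z (p @ b # a # q)])"
    using j by (simp add: T_def config_put_def map_update)
  also have "\<dots> = config z (U[j := p @ a # b # q]) - config z (U[j := p @ b # a # q])"
    using j by (simp add: config_def map_update linear_diff[OF linear_right_bracket_update])
  finally have "config z U - config z (U[j := p @ b # a # q]) = T (lie (word a) (word b))"
    by (simp add: U(3)[symmetric])
  moreover have "T (lie (word a) (word b)) \<in> A"
  proof (rule words_subset_linear[where T = T and z = z and c = "0 + 0" and l = "length a + length b", OF _ A])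
    show "linear T"
      unfolding T_def using j by (simp add: linear_config_put)
    show "lie (word a) (word b) \<in> words z (0 + 0) (length a + length b)"
      using ab by (intro lie_words word_in_words) auto
    fix w assume w: "length w = length a + length b" "count_list w z = 0 + 0"
    have "T (word w) = config z (U[j := p @ w # q])"
      using j by (simp add: T_def config_put_word)
    moreover have "good (U[j := p @ w # q])"
      using w ab U nth_mem[OF j]
      by (intro good_update) (auto simp: weight_def good_def count_list_0_iff)
    moreover have "factors (U[j := p @ w # q]) < factors U"
      using sum_list_map_update_same[OF j, of length "p @ w # q"] U(3) by (simp add: factors_def)
    ultimately show "T (word w) \<in> A"
      using smaller by simp
  qed
  ultimately show ?thesis by simp
qed

text \<open>Selection sort by adjacent swaps: \<open>move\<close> carries the next entry of the
  target order to the front, after which it joins the fixed prefix \<open>p\<close>.\<close>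

lemma reorder:
  assumes U: "good U" "j < N" "U ! j = p @ l" and l: "mset l' = mset l"
    and smaller: "\<And>V. good V \<Longrightarrow> factors V < factors U \<Longrightarrow> config z V \<in> A"
  shows "config z U - config z (U[j := p @ l']) \<in> A"
  using U l smaller
proof (induction l' arbitrary: U p l)
  case Nil
  then show ?case using subspace_0[OF A] by (metis append_Nil2 diff_self list_update_id mset_zero_iff)
next
  case (Cons a l')
  have "a \<in> set l" using Cons.prems(4) by (metis list.set_intros(1) mset_eq_setD)
  then obtain q r where l: "l = q @ a # r" by (meson split_list)
  have move: "config z V - config z (V[j := p @ a # q' @ r']) \<in> A"
    if "good V" "V ! j = p @ q' @ a # r'" "factors V = factors U" for V q' r'
    using that
  proof (induction q' arbitrary: V r' rule: rev_induct)
    case Nil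
    then show ?case using subspace_0[OF A] by (metis append_Nil diff_self list_update_id)
  next
    case (snoc b q')
    let ?V = "V[j := (p @ q') @ a # b # r']"
    have j: "j < length V" using snoc.prems Cons.prems by (simp add: good_def)
    have "config z V - config z ?V \<in> A"
      using snoc.prems Cons.prems by (intro adjacent_swap) auto
    moreover have "good ?V"
      using snoc.prems Cons.prems nth_mem[OF j] by (intro good_update) (auto simp: weight_def good_def)
    moreover have "factors ?V = factors U"
      using sum_list_map_update_same[OF j, of length "(p @ q') @ a # b # r'"] snoc.prems
      by (simp add: factors_def)
    ultimately show ?case
      using snoc.IH[of ?V "b # r'"] j subspace_add[OF A] by fastforce
  qed
  let ?V = "U[j := (p @ [a]) @ q @ r]"
  have j: "j < length U" using Cons.prems by (simp add: good_def)
  have "config z U - config z ?V \<in> A"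
    using move[of U q r] Cons.prems l by simp
  moreover have "good ?V"
    using Cons.prems l nth_mem[OF j] by (intro good_update) (auto simp: weight_def good_def)
  moreover have "factors ?V = factors U"
    using sum_list_map_update_same[OF j, of length "(p @ [a]) @ q @ r"] Cons.prems l
    by (simp add: factors_def)
  ultimately show ?case
    using Cons.IH[of ?V "p @ [a]" "q @ r"] Cons.prems j l subspace_add[OF A] by fastforce
qed

text \<open>Lexicographic induction on \<open>factors\<close> and \<open>defect\<close>. A factor
  \<open>v\<close> of label \<open>j\<close> other than \<open>[f j]\<close> is replaced by
  \<open>[f j]\<close>, which gives \<open>C\<close> of smaller defect. Sending \<open>f j\<close>
  to \<open>v\<close> in \<open>C\<close> then yields a positive multiple of the original
  configuration modulo \<open>A\<close>.\<close>

lemma config_in: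
  assumes base: "\<And>V. good V \<Longrightarrow> (\<And>j. j < N \<Longrightarrow> set (V ! j) \<subseteq> {[f j]}) \<Longrightarrow> config z V \<in> A"
    and "good U"
  shows "config z U \<in> A"
  using assms(2)
proof (induction "factors U" arbitrary: U rule: less_induct)
  case (less U0)
  note smaller = less.hyps
  have "good U \<Longrightarrow> factors U = factors U0 \<Longrightarrow> config z U \<in> A" for U
  proof (induction "defect U" arbitrary: U rule: less_induct)
    case (less U)
    have len: "length U = N" using less.prems by (simp add: good_def)
    show ?case
    proof (cases "\<forall>j<N. set (U ! j) \<subseteq> {[f j]}")
      case True
      then show ?thesis using base less.prems by blast
    next
      case False
      then obtain j v where j: "j < N" and "v \<in> set (U ! j)" and v: "v \<noteq> [f j]" by auto
      then obtain i where i: "i < length (U ! j)" "U ! j ! i = v" by (auto simp: in_set_conv_nth)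
      have jJ: "j \<in> J" and vz: "v \<noteq> []" "z \<notin> set v"
        using less.prems j i nth_mem[of j U] nth_mem[OF i(1)] by (auto simp: good_def)
      define x where "x = f j"
      define us where "us = (U ! j)[i := [x]]"
      define C where "C = U[j := us]"
      define D :: "('n, 'd) nilp_lie deriv" where "D = Delta x (word v)"
      have xz: "x \<noteq> z" using f_z jJ by (simp add: x_def)
      have Cj: "C ! j = us" "length C = N" using j len by (auto simp: C_def)
      have Cfree: "\<forall>us\<in>set C. \<forall>w\<in>set us. w \<noteq> [] \<and> z \<notin> set w"
        using less.prems xz j len nth_mem[of j U]
        by (auto simp: C_def us_def good_def dest!: set_update_subset_insert[THEN subsetD])
      have Cne: "C ! j' \<noteq> [] \<Longrightarrow> j' < N \<Longrightarrow> j' \<in> J" for j'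
        using less.prems jJ by (cases "j' = j") (auto simp: C_def good_def)
      have "sum_list (map length us) + length v = sum_list (map length (U ! j)) + 1"
        using sum_list_map_update_same[OF i(1), of length "[x]"] i by (simp add: us_def)
      \<comment> \<open>\<open>C\<close> carries one letter where \<open>U\<close> carries
        \<open>v\<close>, so its degree is \<open>Suc K - length v\<close>, as
        \<open>act_word\<close> asks.\<close>
      then have degC: "sum_list (map weight C) + length v = Suc K"
        using sum_list_map_update_same[of j U weight us] j len less.prems
        by (simp add: C_def good_def weight_def)
      have facC: "factors C = factors U0"
        using sum_list_map_update_same[of j U length us] j len less.prems
        by (simp add: C_def factors_def us_def)
      have defC: "defect C < defect U"
      proof -
        have "length (filter (\<lambda>w. w \<noteq> [x]) us) + 1 = length (filter (\<lambda>w. w \<noteq> [x]) (U ! j))"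
          using arg_cong[OF id_take_nth_drop[OF i(1)], of "\<lambda>l. length (filter (\<lambda>w. w \<noteq> [x]) l)"] i v
          unfolding us_def x_def upd_conv_take_nth_drop[OF i(1)] by simp
        then show ?thesis
          using defect_update[of j U us] j len by (simp add: C_def x_def)
      qed
      \<comment> \<open>If \<open>v\<close> is a letter, \<open>C\<close> has degree
        \<open>K\<close> and the induction hypothesis with \<open>act_gen\<close> applies. Otherwise
        \<open>C\<close> has smaller degree and lies outside the induction, but
        \<open>act_word\<close> asks only for its bidegree.\<close>
      have DC: "apply_deriv D (config z C) \<in> A"
      proof (cases "length v = 1")
        case True
        then obtain b where b: "v = [b]" by (cases v) auto
        then have "good C"
          unfolding good_def using degC Cj Cfree Cne by auto
        then have "config z C \<in> A"
          using less.hyps defC facC by blast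
        then show ?thesis
          using act_gen[of x b] b vz xz v by (auto simp: D_def x_def)
      next
        case False
        then have "2 \<le> length v" using vz by (simp add: Suc_le_eq numeral_2_eq_2 nat_neq_iff)
        moreover have "2 \<le> sum_list (map weight C)"
        proof -
          have "weight us \<in> set (map weight C)" using Cj j by (metis image_eqI list.set_map nth_mem)
          moreover have "2 \<le> weight us"
          proof -
            have "1 \<in> set (map length us)"
              using i set_update_memI[of i "U ! j" "[x]"] by (force simp: us_def)
            then show ?thesis using member_le_sum_list[of 1 "map length us"] by (simp add: weight_def)
          qed
          ultimately show ?thesis using member_le_sum_list[of "weight us" "map weight C"] by simp
        qed
        ultimately show ?thesis
          unfolding D_def using act_word[OF xz vz(2)] degC config_words[of C z] Cfree Cj by auto
      qed
      define P where "P = (SIGMA j:{..<N}. {..<length (C ! j)})"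
      define tm where "tm = (\<lambda>(j', i'). config_put z C j' i' (apply_deriv D (word (C ! j' ! i'))))"
      \<comment> \<open>The multiple of \<open>config z U\<close> that a term contributes modulo
        \<open>A\<close>. The sum counts the factors \<open>[x]\<close> of label \<open>j\<close> in
        \<open>C\<close>, and position \<open>i\<close> is one of them.\<close>
      define c :: "nat \<times> nat \<Rightarrow> real" where
        "c = (\<lambda>(j', i'). if j' = j \<and> C ! j ! i' = [x] then 1 else 0)"
      have fin: "finite P" by (simp add: P_def)
      have "tm p - c p *\<^sub>R config z U \<in> A" if "p \<in> P" for p
      proof -
        obtain j' i' where p: "p = (j', i')" by (cases p)
        with that have j': "j' < N" "i' < length (C ! j')" by (auto simp: P_def)
        \<comment> \<open>In \<open>hit\<close> the term is \<open>U\<close> with label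
          \<open>j\<close> permuted. In \<open>other\<close> it vanishes, since \<open>f\<close> is
          injective on \<open>J\<close>. In \<open>rest\<close> the factor was already counted by
          \<open>defect\<close>, so the defect stays below that of \<open>U\<close>.\<close>
        consider (hit) "j' = j" "C ! j ! i' = [x]" | (other) "j' \<noteq> j" "C ! j' ! i' = [f j']"
          | (rest) "C ! j' ! i' \<noteq> [f j']" using x_def by blast
        then show ?thesis
        proof cases
          case hit
          have "tm p = config z (U[j := us[i' := v]])"
            using hit j' Cj by (simp add: p tm_def D_def config_put_word) (simp add: C_def)
          moreover have "mset (us[i' := v]) = mset (U ! j)"
          proof (cases "i' = i")
            case True
            then show ?thesis using i by (auto simp: us_def)
          next
            case False
            then have "us[i' := v] = (U ! j)[i := U ! j ! i', i' := U ! j ! i]"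
              using hit Cj i by (simp add: us_def)
            then show ?thesis
              using mset_swap[of i' "U ! j" i] i j' hit Cj by (simp add: us_def)
          qed
          ultimately have "config z U - tm p \<in> A"
            using reorder[of U j "[]" "U ! j" "us[i' := v]"] less.prems smaller j by auto
          then show ?thesis
            using hit subspace_neg[OF A, of "config z U - tm p"] by (simp add: p c_def)
        next
          case other
          then have "j' \<in> J" using Cne[of j'] j' by (cases "C ! j' = []") auto
          then have "f j' \<noteq> x" using inj jJ other by (auto simp: x_def inj_on_def)
          then have "tm p = 0"
            using other j' Cj by (simp add: p tm_def D_def linear_0[OF linear_config_put])
          then show ?thesis using other subspace_0[OF A] by (simp add: p c_def)
        next
          case rest
          let ?w = "C ! j' ! i'"
          have w: "z \<notin> set ?w" "?w \<noteq> []" using Cfree Cj j' by (metis nth_mem)+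
          have "apply_deriv D (word ?w) \<in> words z (0 + 0) (length ?w + (length v - 1))"
          proof (rule deriv_words)
            show "word ?w \<in> words z 0 (length ?w)" using w by (intro word_in_words) auto
            show "apply_deriv D (gen i) \<in> words z (count_list [i] z + 0) (Suc (length v - 1))" for i
              using vz xz by (auto simp: D_def subspace_0[OF subspace_words] Suc_diff_1 intro!: word_in_words)
          qed
          moreover have "config_put z C j' i' (word w') \<in> A"
            if w': "length w' = length ?w + (length v - 1)" "count_list w' z = 0 + 0" for w'
          proof -
            let ?C = "C[j' := (C ! j')[i' := w']]"
            have w'z: "w' \<noteq> []" "z \<notin> set w'" using w' w by (auto simp: count_list_0_iff)
            have j'C: "j' < length C" using j' Cj by simp
            have "sum_list (map length ((C ! j')[i' := w'])) + length ?w = sum_list (map length (C ! j')) + length w'"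
              using sum_list_map_update_same[OF j'(2), of length w'] .
            then have "sum_list (map weight ?C) = K"
              using sum_list_map_update_same[OF j'C, of weight "(C ! j')[i' := w']"] degC w' vz
              by (simp add: weight_def) (cases v; simp)
            moreover have "\<forall>us\<in>set ?C. \<forall>w\<in>set us. w \<noteq> [] \<and> z \<notin> set w"
              using Cfree w'z nth_mem[OF j'C]
              by (auto dest!: set_update_subset_insert[THEN subsetD])
            moreover have "\<forall>j<N. ?C ! j \<noteq> [] \<longrightarrow> j \<in> J"
              using Cne j'C by (auto simp: nth_list_update)
            ultimately have "good ?C"
              using Cj by (simp add: good_def)
            moreover have "factors ?C = factors U0"
              using sum_list_map_update_same[OF j'C, of length "(C ! j')[i' := w']"] facC
              by (simp add: factors_def)
            moreover have "defect ?C \<le> defect C"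
            proof -
              have "length (filter (\<lambda>w. w \<noteq> [f j']) ((C ! j')[i' := w'])) \<le> length (filter (\<lambda>w. w \<noteq> [f j']) (C ! j'))"
                using arg_cong[OF id_take_nth_drop[OF j'(2)], of "\<lambda>l. length (filter (\<lambda>w. w \<noteq> [f j']) l)"] rest
                unfolding upd_conv_take_nth_drop[OF j'(2)] by simp
              then show ?thesis using defect_update[OF j'C, of "(C ! j')[i' := w']"] by simp
            qed
            ultimately have "config z ?C \<in> A" using less.hyps[of ?C] defC by simp
            then show ?thesis using j' j'C by (simp add: config_put_word)
          qed
          ultimately have "tm p \<in> A"
            unfolding p tm_def prod.case
            using words_subset_linear[OF linear_config_put[of j' C z i'] A] j' Cj by blast
          moreover have "c p = 0" using rest by (auto simp: p c_def x_def)
          ultimately show ?thesis by simp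
        qed
      qed
      then have "(\<Sum>p\<in>P. tm p - c p *\<^sub>R config z U) \<in> A"
        by (intro subspace_sum[OF A])
      then have "(\<Sum>p\<in>P. tm p) - (\<Sum>p\<in>P. c p) *\<^sub>R config z U \<in> A"
        by (simp add: sum_subtractf scaleR_sum_left)
      moreover have "(\<Sum>p\<in>P. tm p) = apply_deriv D (config z C)"
        using xz Cj by (subst deriv_config) (auto simp: D_def P_def tm_def)
      ultimately have "(\<Sum>p\<in>P. c p) *\<^sub>R config z U \<in> A"
        using DC subspace_diff[OF A] by fastforce
      moreover have "1 \<le> (\<Sum>p\<in>P. c p)"
        using member_le_sum[of "(j, i)" P c] fin i j Cj by (auto simp: c_def P_def us_def)
      ultimately show ?thesis
        using subspace_scale[OF A, of _ "1 / (\<Sum>p\<in>P. c p)"] by fastforce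
    qed
  qed
  then show ?case using less.prems by blast
qed

end

subsection \<open>One degree at a time\<close>

definition configs :: "'a \<Rightarrow> nat \<Rightarrow> nat \<Rightarrow> 'a list list list set" where
  "configs z N K = {U. length U = N \<and> sum_list (map weight U) = K \<and>
     (\<forall>us\<in>set U. \<forall>w\<in>set us. w \<noteq> [] \<and> z \<notin> set w)}"

lemma config_Cons: "U \<noteq> [] \<Longrightarrow> config z (us # U) = lie (label z us) (config z U)"
  by (simp add: config_def right_bracket_Cons)

lemma span_linear_image:
  assumes "linear T" "subspace A" "\<And>b. b \<in> B \<Longrightarrow> T b \<in> A" "a \<in> span B"
  shows "T a \<in> A"
  using span_minimal[of B "T -` A", OF _ linear_subspace_vimage[OF assms(1,2)]] assms(3,4) by auto

text \<open>\<open>ad x\<close> is a derivation, hence acts on one label at a time, where it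
  prepends the factor \<open>[x]\<close>.\<close>

lemma lie_gen_config:
  assumes "x \<noteq> z" "U \<noteq> []" "U \<in> configs z N K"
  shows "lie (gen x) (config z U) \<in> (span (config z ` configs z N (Suc K)) :: ('a, 'd) nilp_lie set)"
  using assms(2,3)
proof (induction U arbitrary: N K)
  case (Cons us U)
  have front: "config z (([x] # us) # U) \<in> (span (config z ` configs z N (Suc K)) :: ('a, 'd) nilp_lie set)"
    using Cons.prems assms(1) by (intro span_base imageI) (auto simp: configs_def weight_def)
  have x_us: "lie (gen x) (label z us) = (label z ([x] # us) :: ('a, 'd) nilp_lie)"
    by (simp add: label_def)
  show ?case
  proof (cases "U = []")
    case True
    with front x_us show ?thesis by (simp add: config_def)
  next
    case False
    have "lie (gen x) (config z (us # U)) =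
        config z (([x] # us) # U) + lie (label z us) (lie (gen x) (config z U) :: ('a, 'd) nilp_lie)"
      by (simp add: config_Cons[OF False] lie_lie_left flip: x_us)
    moreover have "lie (label z us) (lie (gen x) (config z U)) \<in>
        (span (config z ` configs z N (Suc K)) :: ('a, 'd) nilp_lie set)"
    proof (rule span_linear_image[OF linear_lie_right subspace_span])
      show "lie (gen x) (config z U) \<in>
          (span (config z ` configs z (length U) (Suc (sum_list (map weight U)))) :: ('a, 'd) nilp_lie set)"
        using Cons.prems by (intro Cons.IH[OF False]) (simp add: configs_def)
      fix b :: "('a, 'd) nilp_lie"
      assume "b \<in> config z ` configs z (length U) (Suc (sum_list (map weight U)))"
      then obtain V where V: "b = config z V" "V \<in> configs z (length U) (Suc (sum_list (map weight U)))"
        by blast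
      then have "V \<noteq> []" using False by (auto simp: configs_def)
      then have "lie (label z us) b = config z (us # V)"
        using V by (simp add: config_Cons)
      moreover have "us # V \<in> configs z N (Suc K)"
        using V Cons.prems by (auto simp: configs_def)
      ultimately show "lie (label z us) b \<in> span (config z ` configs z N (Suc K))"
        by (simp add: span_base)
    qed
    ultimately show ?thesis
      using front by (simp add: span_add)
  qed
qed simp

text \<open>Induction along the word. A leading \<open>z\<close> followed by further occurrences
  becomes an empty label, and another leading letter is absorbed by \<open>lie_gen_config\<close>.
  If \<open>z\<close> occurs only in front of \<open>ws\<close>, then
  \<open>[z,ws] = -[ws,z]\<close> is a single label.\<close>

lemma word_in_span_configs:
  assumes "z \<in> set ws"
  shows "word ws \<in> (span (config z ` configs z (count_list ws z) (length ws)) :: ('a, 'd) nilp_lie set)"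
  using assms
proof (induction ws)
  case (Cons x ws)
  let ?T = "config z ` configs z (count_list (x # ws) z) (length (x # ws)) :: ('a, 'd) nilp_lie set"
  consider (last) "ws = []" | (only) "ws \<noteq> []" "x = z" "z \<notin> set ws" | (front) "ws \<noteq> []" "x = z" "z \<in> set ws"
    | (letter) "ws \<noteq> []" "x \<noteq> z" "z \<in> set ws" using Cons.prems by auto
  then show ?case
  proof cases
    case last
    have "config z [[]] \<in> ?T"
      using last Cons.prems by (intro imageI) (auto simp: configs_def weight_def)
    then show ?thesis
      using last Cons.prems by (auto simp: config_def label_def intro: span_base)
  next
    case only
    have "config z [[ws]] \<in> ?T"
      using only by (intro imageI) (auto simp: configs_def weight_def count_list_0_iff)
    then have "- config z [[ws]] \<in> span ?T"
      by (intro span_neg span_base)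
    moreover have "word (x # ws) = (- config z [[ws]] :: ('a, 'd) nilp_lie)"
      using only lie_anticomm[of "word ws" "gen z :: ('a, 'd) nilp_lie"]
      by (simp add: right_bracket_Cons config_def label_def)
    ultimately show ?thesis by simp
  next
    case front
    have "lie (gen z) (word ws) \<in> span ?T"
    proof (rule span_linear_image[OF linear_lie_right subspace_span _ Cons.IH])
      fix b :: "('a, 'd) nilp_lie"
      assume "b \<in> config z ` configs z (count_list ws z) (length ws)"
      then obtain V where V: "b = config z V" "V \<in> configs z (count_list ws z) (length ws)"
        by blast
      then have "V \<noteq> []" using front by (auto simp: configs_def count_list_0_iff)
      then have "lie (gen z) b = config z ([] # V)"
        using V by (simp add: config_Cons label_def)
      moreover have "[] # V \<in> configs z (count_list (x # ws) z) (length (x # ws))"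
        using V front by (auto simp: configs_def weight_def)
      ultimately show "lie (gen z) b \<in> span ?T"
        by (simp add: span_base)
    qed (use front in auto)
    then show ?thesis using front by (simp add: right_bracket_Cons)
  next
    case letter
    have "lie (gen x) (word ws) \<in> span ?T"
    proof (rule span_linear_image[OF linear_lie_right subspace_span _ Cons.IH])
      fix b :: "('a, 'd) nilp_lie"
      assume "b \<in> config z ` configs z (count_list ws z) (length ws)"
      then obtain V where V: "b = config z V" "V \<in> configs z (count_list ws z) (length ws)"
        by blast
      then have "V \<noteq> []" using letter by (auto simp: configs_def count_list_0_iff)
      then show "lie (gen x) b \<in> span ?T"
        using lie_gen_config[OF letter(2) _ V(2)] letter V(1) by simp
    qed (use letter in auto)
    then show ?thesis using letter by (simp add: right_bracket_Cons)
  qed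
qed simp

section \<open>Derivations and powers of \<open>ad\<close> acting on one slot\<close>

lemma deriv_right_bracket_slot:
  assumes "\<forall>a\<in>set as \<union> set bs. apply_deriv D a = 0"
  shows "apply_deriv D (right_bracket (as @ y # bs)) = right_bracket (as @ apply_deriv D y # bs)"
  using assms
proof (induction as)
  case Nil
  have "apply_deriv D (right_bracket bs) = 0"
    unfolding deriv_right_bracket using Nil
    by (intro sum.neutral) (auto simp: linear_0[OF linear_right_bracket_update])
  then show ?case
    by (cases "bs = []") (simp_all add: right_bracket_Cons apply_deriv_lie)
next
  case (Cons a as)
  then show ?case by (simp add: right_bracket_Cons apply_deriv_lie)
qed

lemma deriv_ad_power:
  "apply_deriv D a = 0 \<Longrightarrow> apply_deriv D ((lie a ^^ r) y) = (lie a ^^ r) (apply_deriv D y)"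
  by (induction r) (simp_all add: apply_deriv_lie)

lemma linear_ad_power: "linear (lie a ^^ r)"
proof (induction r)
  case 0
  show ?case by (simp add: id_def linear_ident)
next
  case (Suc r)
  show ?case using linear_compose[OF Suc linear_lie_right[of a]] by (simp add: o_def)
qed

lemma ad_power_words:
  "x \<noteq> s \<Longrightarrow> g \<in> words s c l \<Longrightarrow> (lie (gen x) ^^ r) g \<in> words s c (r + l)"
proof (induction r)
  case (Suc r)
  then show ?case using lie_gen_words[of "(lie (gen x) ^^ r) g" s c "r + l" x] by simp
qed simp

lemma label_replicate: "label z (replicate r [x]) = (lie (gen x) ^^ r) (gen z)"
  by (simp add: label_def)

lemma ad_power_word: "(lie (gen x) ^^ r) (gen y) = word (replicate r x @ [y])"
  by (induction r) (simp_all add: right_bracket_Cons)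

lemma label_words_other:
  assumes "s \<noteq> z" "\<forall>w\<in>set us. s \<notin> set w"
  shows "label z us \<in> (words s 0 (weight us) :: ('a, 'd) nilp_lie set)"
  using assms
proof (induction us)
  case Nil
  then show ?case using word_in_words[of "[z]" 1 s 0] by (simp add: label_def weight_def)
next
  case (Cons u us)
  then have "lie (word u) (label z us) \<in>
      (words s (0 + 0) (length u + weight us) :: ('a, 'd) nilp_lie set)"
    by (intro lie_words word_in_words) auto
  then show ?case by (simp add: label_def weight_def)
qed

lemma slot_words:
  assumes "s \<noteq> z" "\<forall>us\<in>set as \<union> set bs. \<forall>w\<in>set us. s \<notin> set w"
  shows "right_bracket (map (label z) as @ gen s # map (label z) bs) \<in>
    (words s 1 (Suc (sum_list (map weight as) + sum_list (map weight bs))) :: ('a, 'd) nilp_lie set)"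
  using assms(2)
proof (induction as)
  case Nil
  have tail: "config z V \<in> (words s 0 (sum_list (map weight V)) :: ('a, 'd) nilp_lie set)"
    if "\<forall>us\<in>set V. \<forall>w\<in>set us. s \<notin> set w" for V
    using that
  proof (induction V)
    case (Cons us V)
    show ?case
    proof (cases "V = []")
      case True
      with Cons.prems label_words_other[OF assms(1), of us] show ?thesis by (simp add: config_def)
    next
      case False
      with Cons lie_words[OF label_words_other[OF assms(1), of us] Cons.IH] show ?thesis
        by (simp add: config_Cons)
    qed
  qed (simp add: config_def subspace_0[OF subspace_words])
  have s: "gen s \<in> (words s 1 1 :: ('a, 'd) nilp_lie set)"
    using word_in_words[of "[s]" 1 s 1] by simp
  show ?case
  proof (cases "bs = []")
    case False
    with lie_words[OF s tail[of bs]] Nil show ?thesis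
      by (simp add: right_bracket_Cons config_def)
  qed (use s in simp)
next
  case (Cons us as)
  with lie_words[OF label_words_other[OF assms(1), of us] Cons.IH] show ?case
    by (simp add: right_bracket_Cons ac_simps)
qed

text \<open>For \<open>a \<noteq> b\<close>, \<open>Delta a (gen b)\<close> is an off-diagonal
  matrix unit of \<open>sl\<close>; \<open>move\<close> records stability of \<open>S\<close> under
  these.\<close>

locale sl_closed =
  fixes S :: "('n::finite, 'd::finite) nilp_lie deriv set"
  assumes S: "subspace S" and lie_S: "\<And>D E. D \<in> S \<Longrightarrow> E \<in> S \<Longrightarrow> lie D E \<in> S"
    and move: "\<And>a b D. a \<noteq> b \<Longrightarrow> D \<in> S \<Longrightarrow> lie (Delta a (gen b)) D \<in> S"

lemma (in sl_closed) Delta_zero_S: "Delta i 0 \<in> S"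
  using subspace_0[OF S] linear_0[OF linear_Delta, of i] by metis

text \<open>The induction step for derivations of degree \<open>k\<close>, whose values have length
  \<open>Suc k\<close>. The hypothesis \<open>lower\<close> covers degrees 1 to
  \<open>k - 1\<close>; \<open>triple\<close> supplies the words free of \<open>z\<close> when
  \<open>k = 1\<close>.\<close>

locale degree_step = sl_closed S for S :: "('n::finite, 'd::finite) nilp_lie deriv set" +
  fixes k :: nat and p :: 'n
  assumes k: "1 \<le> k" and card: "3 \<le> CARD('n)" and AD_S: "AD p k \<in> S"
    and triple: "\<And>z a b. z \<noteq> a \<Longrightarrow> z \<noteq> b \<Longrightarrow> a \<noteq> b \<Longrightarrow> Delta z (lie (gen a) (gen b)) \<in> S"
    and lower: "\<And>i ws. 2 \<le> length ws \<Longrightarrow> length ws \<le> k \<Longrightarrow> Delta i (word ws) \<in> S"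
begin

lemma Delta_in_S_words:
  assumes "\<And>ws. length ws = l \<Longrightarrow> count_list ws z = c \<Longrightarrow> Delta i (word ws) \<in> S"
    and "g \<in> words z c l"
  shows "Delta i g \<in> S"
  using words_subset_linear[OF linear_Delta S assms] .

lemma lower_words: "g \<in> words z c l \<Longrightarrow> 2 \<le> l \<Longrightarrow> l \<le> k \<Longrightarrow> Delta i g \<in> S"
  by (erule Delta_in_S_words[rotated]) (simp add: lower)

text \<open>Polarisation with \<open>A\<close> the preimage of \<open>S\<close> under
  \<open>Delta z\<close>. By \<open>lie_Delta_free\<close>, acting on \<open>A\<close> means
  bracketing in \<open>S\<close>: \<open>act_gen\<close> becomes \<open>move\<close>, and
  \<open>act_word\<close> becomes a bracket of two derivations of lower degree.\<close>

lemma polarise: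
  assumes f: "inj_on f J" "\<And>j. j \<in> J \<Longrightarrow> f j \<noteq> z"
    and base: "\<And>V. V \<in> configs z N (Suc k) \<Longrightarrow> (\<And>j. j < N \<Longrightarrow> V ! j \<noteq> [] \<Longrightarrow> j \<in> J) \<Longrightarrow>
      (\<And>j. j < N \<Longrightarrow> V ! j = replicate (length (V ! j)) [f j]) \<Longrightarrow> Delta z (config z V) \<in> S"
    and U: "U \<in> configs z N (Suc k)" "\<And>j. j < N \<Longrightarrow> U ! j \<noteq> [] \<Longrightarrow> j \<in> J"
  shows "Delta z (config z U) \<in> S"
proof -
  interpret polarisation z f J "Delta z -` S" N "Suc k"
  proof
    show "subspace (Delta z -` S)"
      by (intro linear_subspace_vimage linear_Delta S)
    have z_free: "z \<notin> set v \<Longrightarrow> word v \<in> (words z 0 (length v) :: ('n, 'd) nilp_lie set)" for v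
      by (intro word_in_words) auto
    show "apply_deriv (Delta a (gen b)) g \<in> Delta z -` S"
      if "a \<noteq> z" "b \<noteq> z" "b \<noteq> a" "g \<in> Delta z -` S" for a b g
      using move[of a b "Delta z g"] lie_Delta_free[of a z "gen b" 1 g] z_free[of "[b]"] that
      by simp
    show "apply_deriv (Delta a (word v)) g \<in> Delta z -` S"
      if "a \<noteq> z" "z \<notin> set v" "2 \<le> length v" "2 \<le> l" "l + length v = Suc (Suc k)" "g \<in> words z N l" for a v g l
      using lie_S[OF lower[of v a] lower_words[of g z N l z]]
        lie_Delta_free[of a z "word v" "length v" g] z_free[of v] that
      by simp
  qed (use f in auto)
  have good_iff: "good V \<longleftrightarrow> V \<in> configs z N (Suc k) \<and> (\<forall>j<N. V ! j \<noteq> [] \<longrightarrow> j \<in> J)" for V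
    unfolding good_def configs_def by auto
  have "config z U \<in> Delta z -` S"
  proof (rule config_in)
    fix V assume V: "good V" "\<And>j. j < N \<Longrightarrow> set (V ! j) \<subseteq> {[f j]}"
    then have "V ! j = replicate (length (V ! j)) [f j]" if "j < N" for j
      using that by (intro replicate_eqI) auto
    then show "config z V \<in> Delta z -` S"
      using V(1) base unfolding good_iff by blast
  qed (use U in \<open>auto simp: good_iff\<close>)
  then show ?thesis by simp
qed

text \<open>The bracket of \<open>s \<mapsto> ad x\<^sup>r z\<close> and \<open>z \<mapsto> G\<close>, where \<open>G\<close> has \<open>s\<close> in place of the label
  \<open>ad x\<^sup>r z\<close>, exchanges the distinguished letter \<open>z\<close> for \<open>s\<close>. Both a spare letter \<open>s\<close> and
  \<open>s = x\<close> are used.\<close>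

lemma slot_reduction:
  assumes r: "1 \<le> r" and ne: "as @ bs \<noteq> []" and x: "x \<noteq> z" and s: "s \<noteq> z"
    and V: "as @ replicate r [x] # bs \<in> configs z N (Suc k)"
    and free: "\<And>us w. us \<in> set as \<union> set bs \<Longrightarrow> w \<in> set us \<Longrightarrow> s \<notin> set w"
    and H: "Delta s ((lie (gen x) ^^ r) (right_bracket (map (label z) as @ gen s # map (label z) bs))) \<in> S"
  shows "Delta z (config z (as @ replicate r [x] # bs)) \<in> S"
proof -
  define Y :: "('n, 'd) nilp_lie" where "Y = (lie (gen x) ^^ r) (gen z)"
  define G :: "('n, 'd) nilp_lie" where "G = right_bracket (map (label z) as @ gen s # map (label z) bs)"
  let ?P = "Delta s Y" and ?Q = "Delta z G"
  have G: "G \<in> words s 1 (Suc (sum_list (map weight as) + sum_list (map weight bs)))"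
    unfolding G_def using free by (intro slot_words s) blast
  have deg: "sum_list (map weight as) + Suc r + sum_list (map weight bs) = Suc k"
    using V by (simp add: configs_def weight_def sum_list_replicate)
  \<comment> \<open>A further label exists, so \<open>Y\<close> has length
    \<open>Suc r \<le> k\<close>; as \<open>r \<ge> 1\<close>, \<open>G\<close> also has length at
    most \<open>k\<close>. Both \<open>?P\<close> and \<open>?Q\<close> therefore fall under
    \<open>lower\<close>.\<close>
  have pos: "1 \<le> sum_list (map weight as) + sum_list (map weight bs)"
    using ne by (cases as; cases bs) (auto simp: weight_def)
  have "?P \<in> S"
    unfolding Y_def ad_power_word using r deg pos by (intro lower) auto
  moreover have "?Q \<in> S"
    using G deg pos r by (intro lower_words) auto
  ultimately have PQ: "lie ?P ?Q \<in> S"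
    by (rule lie_S)
  have "apply_deriv ?P (label z us) = 0" if "us \<in> set as \<union> set bs" for us
    using that free s by (intro Delta_words_zero[where z = s, OF label_words_other]) blast+
  then have "apply_deriv ?P G = right_bracket (map (label z) as @ Y # map (label z) bs)"
    unfolding G_def by (subst deriv_right_bracket_slot) auto
  then have PG: "apply_deriv ?P G = config z (as @ replicate r [x] # bs)"
    by (simp add: config_def Y_def label_replicate)
  have QY: "apply_deriv ?Q Y = (lie (gen x) ^^ r) G"
    unfolding Y_def using x by (subst deriv_ad_power) auto
  \<comment> \<open>On \<open>z\<close>, the element \<open>Y\<close> fills the slot of
    \<open>G\<close>; on \<open>s\<close>, the final \<open>z\<close> of \<open>Y\<close> is
    replaced by \<open>G\<close>, with a minus sign.\<close>
  have "lie ?P ?Q = Delta z (config z (as @ replicate r [x] # bs)) - Delta s ((lie (gen x) ^^ r) G)"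
    using s PG QY
    by (intro deriv_eqI) (auto simp: lie_deriv.rep_eq minus_deriv.rep_eq linear_0[OF linear_apply_deriv])
  then have "Delta z (config z (as @ replicate r [x] # bs)) = lie ?P ?Q + Delta s ((lie (gen x) ^^ r) G)"
    by simp
  then show ?thesis
    using PQ H subspace_add[OF S] unfolding G_def by simp
qed

section \<open>Values with at most one occurrence of the distinguished letter\<close>

lemma obtain_other: obtains c where "c \<noteq> a" "c \<noteq> (b :: 'n)"
proof -
  have "card {a, b} < CARD('n)" using card by (auto simp: card_insert_if)
  then have "{a, b} \<noteq> UNIV" by auto
  then show ?thesis using that by blast
qed

text \<open>For \<open>k > 1\<close>, a third letter \<open>j\<close> splits the word: it comes from
  \<open>z \<mapsto> [b,j]\<close> by substituting the tail \<open>vs\<close> for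
  \<open>j\<close>.\<close>

lemma count_zero:
  assumes "z \<notin> set ws" "length ws = Suc k"
  shows "Delta z (word ws) \<in> S"
proof -
  obtain b vs where ws: "ws = b # vs" "length vs = k" "b \<noteq> z" "z \<notin> set vs"
    using assms by (cases ws) auto
  then have vs: "vs \<noteq> []" using k by auto
  obtain j where j: "j \<noteq> z" "j \<noteq> b" by (rule obtain_other)
  show ?thesis
  proof (cases "k = 1")
    case True
    with ws obtain c where "vs = [c]" by (cases vs) auto
    then show ?thesis
      using ws triple[of z b c] by (cases "b = c") (auto simp: lie_self Delta_zero_S)
  next
    case False
    have "lie (Delta j (word vs)) (Delta z (word [b, j])) \<in> S"
      using False k ws by (intro lie_S lower) auto
    moreover have "lie (Delta j (word vs)) (Delta z (word [b, j])) =
        (Delta z (word ws) :: ('n, 'd) nilp_lie deriv)"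
      using j ws vs lie_Delta_free[OF j(1) word_in_words[of vs k z 0], of "word [b, j]"]
      by (simp add: apply_deriv_lie right_bracket_Cons count_list_0_iff)
    ultimately show ?thesis by simp
  qed
qed

text \<open>The derivation taking \<open>z\<close> to \<open>ad a\<close> to the \<open>k\<close> of
  \<open>i\<close> lies in \<open>S\<close> by \<open>count_zero\<close>; its bracket with
  \<open>i \<mapsto> z\<close> is the difference. Hence the summands of \<open>AD\<close> agree
  modulo \<open>S\<close>.\<close>

lemma power_shift:
  assumes "a \<noteq> z" "a \<noteq> i" "i \<noteq> z"
  shows "Delta z ((lie (gen a) ^^ k) (gen z)) - Delta i ((lie (gen a) ^^ k) (gen i)) \<in> S"
proof -
  let ?E = "Delta i (gen z) :: ('n, 'd) nilp_lie deriv"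
  have "Delta z ((lie (gen a) ^^ k) (gen i)) \<in> S"
    unfolding ad_power_word using assms by (intro count_zero) auto
  then have "lie ?E (Delta z ((lie (gen a) ^^ k) (gen i))) \<in> S"
    using assms by (intro move) auto
  moreover have "lie ?E (Delta z ((lie (gen a) ^^ k) (gen i))) =
      Delta z ((lie (gen a) ^^ k) (gen z)) - Delta i ((lie (gen a) ^^ k) (gen i))"
    using assms by (intro deriv_eqI)
      (auto simp: lie_deriv.rep_eq minus_deriv.rep_eq linear_0[OF linear_apply_deriv] deriv_ad_power)
  ultimately show ?thesis by simp
qed

text \<open>There is a single label, so polarisation needs one letter only and reduces all factors
  to \<open>x\<close>.\<close>

lemma count_one_from_power:
  assumes "x \<noteq> z" "Delta z ((lie (gen x) ^^ k) (gen z)) \<in> S" "count_list ws z = 1" "length ws = Suc k"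
  shows "Delta z (word ws) \<in> S"
proof -
  have base: "Delta z (config z V) \<in> S"
    if V: "V \<in> configs z 1 (Suc k)" "\<And>j. j < 1 \<Longrightarrow> V ! j = replicate (length (V ! j)) [x]" for V
  proof -
    obtain us where us: "V = [us]" using V(1) by (auto simp: configs_def length_Suc_conv)
    then have rep: "us = replicate (length us) [x]" using V(2)[of 0] by simp
    have "weight (replicate (length us) [x]) = Suc k"
      using V(1) rep us by (simp add: configs_def)
    then have "length us = k" by (simp add: weight_def sum_list_replicate)
    then have "config z V = (lie (gen x) ^^ k) (gen z :: ('n, 'd) nilp_lie)"
      using us rep label_replicate[of z k x] by (simp add: config_def)
    then show ?thesis using assms(2) by simp
  qed
  have "Delta z (config z U) \<in> S" if "U \<in> configs z 1 (Suc k)" for U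
    by (rule polarise[where f = "\<lambda>_. x" and J = "{0}", OF _ _ base that]) (use assms(1) in simp_all)
  then have "Delta z b \<in> S" if "b \<in> config z ` configs z (count_list ws z) (length ws)" for b
    using that unfolding assms(3,4) by blast
  moreover have "z \<in> set ws" using assms(3) by (metis count_list_0_iff zero_neq_one)
  ultimately show ?thesis
    by (rule span_linear_image[OF linear_Delta S _ word_in_span_configs])
qed

lemma AD_sum:
  "AD p k = (\<Sum>i\<in>UNIV - {p}. Delta i ((lie (gen p) ^^ k) (gen i)) :: ('n, 'd) nilp_lie deriv)"
proof (rule deriv_eqI)
  fix j
  have "apply_deriv (\<Sum>i\<in>I. Delta i (g i)) (gen j) = (\<Sum>i\<in>I. if j = i then g i else 0)"
    for I and g :: "'n \<Rightarrow> ('n, 'd) nilp_lie"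
    by (induction I rule: infinite_finite_induct) (simp_all add: zero_deriv.rep_eq plus_deriv.rep_eq)
  from this[of "\<lambda>i. (lie (gen p) ^^ k) (gen i)" "UNIV - {p}"]
  have "apply_deriv (\<Sum>i\<in>UNIV - {p}. Delta i ((lie (gen p) ^^ k) (gen i)) :: ('n, 'd) nilp_lie deriv) (gen j) =
      (if j = p then 0 else (lie (gen p) ^^ k) (gen j))"
    by (simp add: sum.delta')
  moreover have "(lie (gen p) ^^ k) (gen p) = (0 :: ('n, 'd) nilp_lie)"
    using k by (cases k) (simp_all add: funpow_swap1 lie_self linear_0[OF linear_ad_power])
  ultimately show "apply_deriv (AD p k :: ('n, 'd) nilp_lie deriv) (gen j) =
      apply_deriv (\<Sum>i\<in>UNIV - {p}. Delta i ((lie (gen p) ^^ k) (gen i))) (gen j)"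
    by (simp add: AD_def)
qed

text \<open>The \<open>CARD('n) - 1\<close> summands of \<open>AD p k\<close> agree modulo
  \<open>S\<close>, so each lies in \<open>S\<close>. As \<open>AD p k\<close> has no summand at
  \<open>p\<close>, the case \<open>z = p\<close> is reached from another letter \<open>i\<close>
  through powers of some \<open>a \<noteq> p\<close>.\<close>

lemma count_one:
  assumes "count_list ws z = 1" "length ws = Suc k"
  shows "Delta z (word ws) \<in> S"
proof -
  have power: "Delta z ((lie (gen p) ^^ k) (gen z)) \<in> S" if z: "z \<noteq> p" for z
  proof -
    let ?g = "\<lambda>i. Delta i ((lie (gen p) ^^ k) (gen i)) :: ('n, 'd) nilp_lie deriv"
    have "?g z - ?g i \<in> S" if "i \<noteq> p" for i
      using z that power_shift[of p z i] subspace_0[OF S] by (cases "i = z") auto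
    then have "(\<Sum>i\<in>UNIV - {p}. ?g z - ?g i) \<in> S"
      by (intro subspace_sum[OF S]) auto
    then have "(\<Sum>i\<in>UNIV - {p}. ?g z - ?g i) + AD p k \<in> S"
      by (intro subspace_add[OF S] AD_S)
    also have "(\<Sum>i\<in>UNIV - {p}. ?g z - ?g i) + AD p k = real (CARD('n) - 1) *\<^sub>R ?g z"
      by (simp add: sum_subtractf AD_sum sum_constant_scaleR)
    finally show ?thesis
      using subspace_scale[OF S, of "real (CARD('n) - 1) *\<^sub>R ?g z" "1 / real (CARD('n) - 1)"] card
      by (simp del: of_nat_diff)
  qed
  have other: "Delta z (word ws) \<in> S" if "z \<noteq> p" "count_list ws z = 1" "length ws = Suc k" for z ws
    using count_one_from_power[OF _ power[OF that(1)], of ws] that by simp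
  show ?thesis
  proof (cases "z = p")
    case True
    \<comment> \<open>\<open>obtain_other\<close> avoids two letters; only \<open>p\<close> has to
      be avoided here, hence the repetition.\<close>
    obtain a where a: "a \<noteq> p" "a \<noteq> p" by (rule obtain_other)
    obtain i where i: "i \<noteq> p" "i \<noteq> a" by (rule obtain_other)
    have "Delta i ((lie (gen a) ^^ k) (gen i)) \<in> S"
      unfolding ad_power_word using i by (intro other) (auto simp: count_list_0_iff)
    then have "Delta p ((lie (gen a) ^^ k) (gen p)) \<in> S"
      using power_shift[of a p i] a i subspace_add[OF S] by fastforce
    then show ?thesis
      using count_one_from_power[of a p ws] a assms True by simp
  next
    case False
    then show ?thesis using assms by (rule other)
  qed
qed

section \<open>Several occurrences of the distinguished letter\<close>

text \<open>With at most \<open>CARD('n) - 2\<close> nonempty labels, the owned letters can avoid a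
  spare letter \<open>s\<close> besides \<open>z\<close>. After polarisation,
  \<open>slot_reduction\<close> with this \<open>s\<close> leaves a value with one occurrence of
  \<open>s\<close>, which \<open>count_one\<close> handles.\<close>

lemma few_labels:
  assumes U: "U \<in> configs z N (Suc k)" and few: "card {j. j < N \<and> U ! j \<noteq> []} \<le> CARD('n) - 2"
  shows "Delta z (config z U) \<in> S"
proof (cases "N \<le> 1")
  case True
  have "N \<noteq> 0" using U by (auto simp: configs_def)
  with True have "N = 1" by simp
  then have "config z U \<in> (words z 1 (Suc k) :: ('n, 'd) nilp_lie set)"
    using U config_words[of U z] by (auto simp: configs_def)
  then show ?thesis
    by (rule Delta_in_S_words[rotated]) (simp add: count_one)
next
  case False
  define J where "J = {j. j < N \<and> U ! j \<noteq> []}"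
  obtain s where s: "s \<noteq> z" "s \<noteq> z" by (rule obtain_other)
  have "card (UNIV - {z, s}) = CARD('n) - 2"
    using s by (simp add: card_Diff_subset)
  then obtain f where f: "f ` J \<subseteq> UNIV - {z, s}" "inj_on f J"
    using card_le_inj[of J "UNIV - {z, s}"] few by (auto simp: J_def)
  show ?thesis
  proof (rule polarise[OF f(2) _ _ U])
    fix V assume V: "V \<in> configs z N (Suc k)" "\<And>j. j < N \<Longrightarrow> V ! j \<noteq> [] \<Longrightarrow> j \<in> J"
      and rep: "\<And>j. j < N \<Longrightarrow> V ! j = replicate (length (V ! j)) [f j]"
    have N: "length V = N" using V by (simp add: configs_def)
    show "Delta z (config z V) \<in> S"
    proof (cases "\<forall>j<N. V ! j = []")
      case True
      \<comment> \<open>All labels equal \<open>z\<close> and there are at least two, so the bracket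
        is 0.\<close>
      then have "V = replicate N []" using N by (intro replicate_eqI) (auto simp: in_set_conv_nth)
      moreover obtain m where "N = Suc (Suc m)" using False by (cases N; cases "N - 1") auto
      moreover have "config z (replicate (Suc (Suc m)) []) = (0 :: ('n, 'd) nilp_lie)" for m
        by (induction m) (auto simp: config_def label_def lie_self)
      ultimately show ?thesis
        using Delta_zero_S by simp
    next
      case nonempty: False
      then obtain j where j: "j < N" "V ! j \<noteq> []" by auto
      define r where "r = length (V ! j)"
      let ?as = "take j V" and ?bs = "drop (Suc j) V"
      have VV: "V = ?as @ replicate r [f j] # ?bs"
        using rep[OF j(1)] j N by (simp add: r_def id_take_nth_drop)
      have sfree: "s \<notin> set w" if "us \<in> set ?as \<union> set ?bs" "w \<in> set us" for us w
      proof -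
        have "us \<in> set V" using that by (auto dest: in_set_takeD in_set_dropD)
        then obtain j' where j': "j' < N" "us = V ! j'" using N by (auto simp: in_set_conv_nth)
        then have "w = [f j']" using rep[OF j'(1)] that by (metis in_set_replicate)
        moreover have "j' \<in> J" using V(2)[OF j'(1)] j' that(2) by (cases "V ! j' = []") simp_all
        ultimately show ?thesis using f by auto
      qed
      have "f j \<noteq> z" "f j \<noteq> s" using f V(2) j by auto
      have "Delta z (config z (?as @ replicate r [f j] # ?bs)) \<in> S"
      proof (rule slot_reduction)
        show "1 \<le> r" using j by (simp add: r_def Suc_le_eq)
        show "?as @ ?bs \<noteq> []" using False N j by auto
        show "?as @ replicate r [f j] # ?bs \<in> configs z N (Suc k)"
          using V(1) VV by simp
        have "(lie (gen (f j)) ^^ r) (right_bracket (map (label z) ?as @ gen s # map (label z) ?bs)) \<in>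
            words s 1 (r + Suc (sum_list (map weight ?as) + sum_list (map weight ?bs)))"
          using sfree s \<open>f j \<noteq> s\<close> by (intro ad_power_words slot_words) blast+
        moreover have "r + Suc (sum_list (map weight ?as) + sum_list (map weight ?bs)) = Suc k"
        proof -
          have "sum_list (map weight (?as @ replicate r [f j] # ?bs)) = Suc k"
            using V(1) VV by (simp add: configs_def)
          then show ?thesis by (simp add: weight_def sum_list_replicate)
        qed
        ultimately show "Delta s ((lie (gen (f j)) ^^ r) (right_bracket (map (label z) ?as @ gen s # map (label z) ?bs))) \<in> S"
          by (intro Delta_in_S_words[OF count_one]) simp_all
      qed (fact \<open>f j \<noteq> z\<close> s(1) sfree)+
      then show ?thesis using VV by simp
    qed
  qed (use f in \<open>auto simp: J_def\<close>)
qed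

text \<open>With \<open>CARD('n) - 1\<close> nonempty labels no letter is spare, so the slot letter
  is \<open>f j\<close> itself, which the other labels avoid by injectivity. What remains is a
  derivation at \<open>f j\<close> that falls under \<open>few_labels\<close>.\<close>

lemma most_labels:
  assumes U: "U \<in> configs z N (Suc k)" and most: "card {j. j < N \<and> U ! j \<noteq> []} \<le> CARD('n) - 1"
  shows "Delta z (config z U) \<in> S"
proof -
  define J where "J = {j. j < N \<and> U ! j \<noteq> []}"
  have "card (UNIV - {z}) = CARD('n) - 1"
    by (simp add: card_Diff_subset)
  then obtain f where f: "f ` J \<subseteq> UNIV - {z}" "inj_on f J"
    using card_le_inj[of J "UNIV - {z}"] most by (auto simp: J_def)
  show ?thesis
  proof (rule polarise[OF f(2) _ _ U])
    fix V assume V: "V \<in> configs z N (Suc k)" "\<And>j. j < N \<Longrightarrow> V ! j \<noteq> [] \<Longrightarrow> j \<in> J"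
      and rep: "\<And>j. j < N \<Longrightarrow> V ! j = replicate (length (V ! j)) [f j]"
    have N: "length V = N" using V by (simp add: configs_def)
    show "Delta z (config z V) \<in> S"
    proof (cases "card {j. j < N \<and> V ! j \<noteq> []} \<le> CARD('n) - 2")
      case True
      then show ?thesis by (rule few_labels[OF V(1)])
    next
      case False
      then have two: "2 \<le> card {j. j < N \<and> V ! j \<noteq> []}" using card by simp
      then have "{j. j < N \<and> V ! j \<noteq> []} \<noteq> {}" by (metis card.empty not_numeral_le_zero)
      then obtain j where j: "j < N" "V ! j \<noteq> []" by auto
      have "card {j. j < N \<and> V ! j \<noteq> []} \<le> card {..<N}" by (intro card_mono) auto
      with two have "2 \<le> N" by simp
      define r where "r = length (V ! j)"
      let ?as = "take j V" and ?bs = "drop (Suc j) V"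
      have VV: "V = ?as @ replicate r [f j] # ?bs"
        using rep[OF j(1)] j N by (simp add: r_def id_take_nth_drop)
      have jfree: "f j \<notin> set w" if us: "us \<in> set ?as \<union> set ?bs" and w: "w \<in> set us" for us w
      proof -
        obtain j' where j': "j' < N" "us = V ! j'" "j' \<noteq> j"
        proof -
          from us consider "us \<in> set ?as" | "us \<in> set ?bs" by blast
          then show ?thesis
          proof cases
            case 1
            then obtain i where "i < length ?as" "us = ?as ! i" by (metis in_set_conv_nth)
            then show ?thesis using that[of i] j by simp
          next
            case 2
            then obtain i where "i < length ?bs" "us = ?bs ! i" by (metis in_set_conv_nth)
            then show ?thesis using that[of "Suc j + i"] N by simp
          qed
        qed
        then have "w = [f j']" using rep[OF j'(1)] w by (metis in_set_replicate)
        moreover have "j \<in> J" using j V(2) by blast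
        moreover have "j' \<in> J" using V(2)[OF j'(1)] j' w by (cases "V ! j' = []") simp_all
        ultimately show ?thesis using f(2) j'(3) by (auto simp: inj_on_def)
      qed
      have fz: "f j \<noteq> z" using f V(2) j by auto
      have "Delta z (config z (?as @ replicate r [f j] # ?bs)) \<in> S"
      proof (rule slot_reduction)
        show "1 \<le> r" using j by (simp add: r_def Suc_le_eq)
        show "?as @ ?bs \<noteq> []" using \<open>2 \<le> N\<close> N j by auto
        show "?as @ replicate r [f j] # ?bs \<in> configs z N (Suc k)"
          using V(1) VV by simp
        define l where "l = Suc (sum_list (map weight ?as) + sum_list (map weight ?bs))"
        have l: "r + l = Suc k"
        proof -
          have "sum_list (map weight (?as @ replicate r [f j] # ?bs)) = Suc k"
            using V(1) VV by (simp add: configs_def)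
          then show ?thesis by (simp add: weight_def sum_list_replicate l_def)
        qed
        have "right_bracket (map (label z) ?as @ gen (f j) # map (label z) ?bs) \<in> (words (f j) 1 l :: ('n, 'd) nilp_lie set)"
          unfolding l_def using jfree fz by (intro slot_words) blast+
        moreover have "Delta (f j) ((lie (gen (f j)) ^^ r) (word ws)) \<in> S"
          if ws: "length ws = l" "count_list ws (f j) = 1" for ws
        proof -
          have "f j \<in> set ws" using ws by (metis count_list_0_iff zero_neq_one)
          then have "word ws \<in> (span (config (f j) ` configs (f j) 1 l) :: ('n, 'd) nilp_lie set)"
            using word_in_span_configs[of "f j" ws] ws by simp
          moreover have "Delta (f j) ((lie (gen (f j)) ^^ r) b) \<in> S"
            if b: "b \<in> config (f j) ` configs (f j) 1 l" for b
          proof -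
            obtain W where W: "b = config (f j) W" "W \<in> configs (f j) 1 l"
              using b by (rule imageE)
            then have "length W = 1" by (simp add: configs_def)
            then obtain us where "W = [us]" by (cases W) simp_all
            with W have us: "[us] \<in> configs (f j) 1 l" "b = config (f j) [us]" by simp_all
            \<comment> \<open>With \<open>f j\<close> as distinguished letter, each
              \<open>ad (f j)\<close> is an empty label in front. At most one label is nonempty, and
              \<open>1 \<le> CARD('n) - 2\<close>.\<close>
            have "(lie (gen (f j)) ^^ r) (config (f j) [us]) =
                (config (f j) (replicate r [] @ [us]) :: ('n, 'd) nilp_lie)" for r
              by (induction r) (simp_all add: config_Cons label_def)
            moreover have "Delta (f j) (config (f j) (replicate r [] @ [us])) \<in> S"
            proof (rule few_labels)
              show "replicate r [] @ [us] \<in> configs (f j) (Suc r) (Suc k)"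
                using us(1) l by (auto simp: configs_def weight_def sum_list_replicate)
              have "{j. j < Suc r \<and> (replicate r [] @ [us]) ! j \<noteq> []} \<subseteq> {r}"
                by (auto simp: nth_append split: if_splits)
              then have "card {j. j < Suc r \<and> (replicate r [] @ [us]) ! j \<noteq> []} \<le> 1"
                using card_mono[of "{r}"] by fastforce
              then show "card {j. j < Suc r \<and> (replicate r [] @ [us]) ! j \<noteq> []} \<le> CARD('n) - 2"
                using card by linarith
            qed
            ultimately show ?thesis using us by simp
          qed
          ultimately show ?thesis
            using span_linear_image[OF linear_compose[OF linear_ad_power[of r "gen (f j)"] linear_Delta[of "f j"]] S,
                of "config (f j) ` configs (f j) 1 l" "word ws"] by (simp only: o_def)
        qed
        ultimately show "Delta (f j) ((lie (gen (f j)) ^^ r)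
            (right_bracket (map (label z) ?as @ gen (f j) # map (label z) ?bs))) \<in> S"
          using words_subset_linear[OF linear_compose[OF linear_ad_power[of r "gen (f j)"] linear_Delta[of "f j"]] S,
              of l "f j" 1] by (simp only: o_def)
      qed (use fz jfree in auto)
      then show ?thesis using VV by simp
    qed
  qed (use f in \<open>auto simp: J_def\<close>)
qed

section \<open>From configurations back to words, and the bound on the degree\<close>

lemma count_less:
  assumes "count_list ws z < CARD('n)" "length ws = Suc k"
  shows "Delta z (word ws) \<in> S"
proof (cases "z \<in> set ws")
  case True
  have "Delta z (config z U) \<in> S" if "U \<in> configs z (count_list ws z) (Suc k)" for U
  proof (rule most_labels[OF that])
    have "card {j. j < count_list ws z \<and> U ! j \<noteq> []} \<le> card {..<count_list ws z}"
      by (intro card_mono) auto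
    then show "card {j. j < count_list ws z \<and> U ! j \<noteq> []} \<le> CARD('n) - 1"
      using assms(1) by simp
  qed
  then have "Delta z b \<in> S" if "b \<in> config z ` configs z (count_list ws z) (length ws)" for b
    using that unfolding assms(2) by blast
  then show ?thesis
    by (rule span_linear_image[OF linear_Delta S _ word_in_span_configs[OF True]])
next
  case False
  then show ?thesis using assms(2) by (rule count_zero)
qed

text \<open>If \<open>i\<close> occurs too often, some rarer letter \<open>z\<close> takes its
  place. The bracket of \<open>i \<mapsto> z\<close> with \<open>Delta z (word ws)\<close> is
  \<open>- Delta i (word ws)\<close> plus a derivation at \<open>z\<close>, whose value contains
  \<open>z\<close> once more than \<open>ws\<close> does.\<close>

lemma degree_step:
  assumes "Suc k \<le> CARD('n) * (CARD('n) - 1)" "length ws = Suc k"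
  shows "Delta i (word ws) \<in> S"
proof (cases "count_list ws i < CARD('n)")
  case True
  then show ?thesis using assms(2) by (rule count_less)
next
  case False
  \<comment> \<open>Pigeonhole: with \<open>CARD('n) = Suc m\<close>, otherwise the length is at
    least \<open>Suc m + m * m\<close>, above the bound \<open>m + m * m\<close>.\<close>
  have "\<exists>z. z \<noteq> i \<and> Suc (count_list ws z) < CARD('n)"
  proof (rule ccontr)
    assume no: "\<not> ?thesis"
    obtain m where m: "CARD('n) = Suc m" using card by (cases "CARD('n)") auto
    have "m \<le> count_list ws z" if "z \<noteq> i" for z
      using no that m by force
    then have "(\<Sum>z\<in>UNIV - {i}. m) \<le> (\<Sum>z\<in>UNIV - {i}. count_list ws z)"
      by (intro sum_mono) auto
    moreover have "(\<Sum>z\<in>UNIV - {i}. m) = m * m"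
      by (simp add: m card_Diff_subset)
    moreover have "(\<Sum>z\<in>UNIV. count_list ws z) = count_list ws i + (\<Sum>z\<in>UNIV - {i}. count_list ws z)"
      by (simp add: sum.remove)
    moreover have "(\<Sum>z\<in>UNIV. count_list ws z) = length ws"
      by (intro sum_count_set) auto
    moreover have "Suc m \<le> count_list ws i" "length ws \<le> m + m * m"
      using False assms m by auto
    ultimately show False by linarith
  qed
  then obtain z where z: "z \<noteq> i" "Suc (count_list ws z) < CARD('n)" by blast
  let ?E = "Delta i (gen z) :: ('n, 'd) nilp_lie deriv"
  have "apply_deriv ?E (word ws) \<in> words z (count_list ws z + 1) (length ws + 0)"
  proof (rule deriv_words)
    show "apply_deriv ?E (gen j) \<in> words z (count_list [j] z + 1) (Suc 0)" for j
      using z word_in_words[of "[z]" 1 z 1] by (auto simp: subspace_0[OF subspace_words])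
  qed (simp add: word_in_words)
  then have "Delta z (apply_deriv ?E (word ws)) \<in> S"
    using z assms count_less Delta_in_S_words[of "length ws" z "count_list ws z + 1" z] by simp
  moreover have "lie ?E (Delta z (word ws)) \<in> S"
    using z assms by (intro move count_less) auto
  moreover have "Delta i (word ws) = Delta z (apply_deriv ?E (word ws)) - lie ?E (Delta z (word ws))"
  proof (rule deriv_eqI)
    fix j
    show "apply_deriv (Delta i (word ws)) (gen j) =
        apply_deriv (Delta z (apply_deriv ?E (word ws)) - lie ?E (Delta z (word ws))) (gen j)"
      using z by (simp add: lie_deriv.rep_eq minus_deriv.rep_eq linear_0[OF linear_apply_deriv])
  qed
  ultimately show ?thesis using subspace_diff[OF S] by simp
qed

end

subsection \<open>Generation\<close>

context sl_closed
begin

section \<open>Degree one: moving the generator \<open>Delta\<close> by \<open>sl\<close>\<close>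

lemma flip_triple: "Delta z (lie (gen a) (gen c)) \<in> S \<Longrightarrow> Delta z (lie (gen c) (gen a)) \<in> S"
  using subspace_neg[OF S, of "Delta z (lie (gen a) (gen c))"]
  by (simp add: lie_anticomm[of "gen c" "gen a"] linear_neg[OF linear_Delta])

text \<open>Bracketing once with \<open>a \<mapsto> z\<close> gives
  \<open>z \<mapsto> [z,c]\<close>, \<open>a \<mapsto> -[a,c]\<close>. The second bracket kills the
  value at \<open>z\<close> and leaves \<open>-2 [z,c]\<close> at \<open>a\<close>.\<close>

lemma swap_triple:
  assumes "z \<noteq> a" "z \<noteq> c" "a \<noteq> c" "Delta z (lie (gen a) (gen c)) \<in> S"
  shows "Delta a (lie (gen z) (gen c)) \<in> S"
proof -
  let ?E = "Delta a (gen z) :: ('n, 'd) nilp_lie deriv"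
  have "lie ?E (lie ?E (Delta z (lie (gen a) (gen c)))) \<in> S"
    using assms by (intro move) auto
  moreover have "lie ?E (lie ?E (Delta z (lie (gen a) (gen c)))) = (-2) *\<^sub>R Delta a (lie (gen z) (gen c))"
  proof (rule deriv_eqI)
    fix j
    show "apply_deriv (lie ?E (lie ?E (Delta z (lie (gen a) (gen c))))) (gen j) =
        apply_deriv ((-2) *\<^sub>R Delta a (lie (gen z) (gen c))) (gen j)"
      using assms(1-3)
      by (simp add: lie_deriv.rep_eq scaleR_deriv.rep_eq linear_0[OF linear_apply_deriv]
          linear_neg[OF linear_apply_deriv] apply_deriv_lie scaleR_2 uminus_deriv.rep_eq minus_deriv.rep_eq)
  qed
  ultimately show ?thesis
    using subspace_scale[OF S, of "(-2) *\<^sub>R Delta a (lie (gen z) (gen c))" "- 1 / 2"] by simp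
qed

lemma replace_triple:
  assumes "z \<noteq> a" "a \<noteq> c" "b \<noteq> z" "b \<noteq> a" "Delta z (lie (gen a) (gen c)) \<in> S"
  shows "Delta z (lie (gen b) (gen c)) \<in> S"
proof -
  let ?E = "Delta a (gen b) :: ('n, 'd) nilp_lie deriv"
  have "lie ?E (Delta z (lie (gen a) (gen c))) \<in> S"
    using assms by (intro move) auto
  moreover have "lie ?E (Delta z (lie (gen a) (gen c))) = Delta z (lie (gen b) (gen c))"
  proof (rule deriv_eqI)
    fix j
    show "apply_deriv (lie ?E (Delta z (lie (gen a) (gen c)))) (gen j) =
        apply_deriv (Delta z (lie (gen b) (gen c))) (gen j)"
      using assms(1-4)
      by (simp add: lie_deriv.rep_eq linear_0[OF linear_apply_deriv] apply_deriv_lie)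
  qed
  ultimately show ?thesis by simp
qed

text \<open>First the source is moved to \<open>z\<close> by \<open>swap_triple\<close>; then
  \<open>replace_triple\<close> turns one argument into \<open>a\<close> and the other into
  \<open>b\<close>.\<close>

lemma all_triples:
  assumes distinct: "p \<noteq> q" "p \<noteq> r" "q \<noteq> r" and "Delta p (lie (gen q) (gen r)) \<in> S"
    and zab: "z \<noteq> a" "z \<noteq> b" "a \<noteq> b"
  shows "Delta z (lie (gen a) (gen b)) \<in> S"
proof -
  have "\<exists>q r. z \<noteq> q \<and> z \<noteq> r \<and> q \<noteq> r \<and> Delta z (lie (gen q) (gen r)) \<in> S"
  proof -
    consider "z = p" | "z = q" | "z = r" | "z \<notin> {p, q, r}" by blast
    then show ?thesis
    proof cases
      case 1
      then show ?thesis using assms(1-4) by auto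
    next
      case 2
      have "Delta q (lie (gen p) (gen r)) \<in> S"
        using assms(1-4) by (rule swap_triple)
      then show ?thesis using 2 assms(1-3) by metis
    next
      case 3
      have "Delta r (lie (gen p) (gen q)) \<in> S"
        using assms(2,1) assms(3)[symmetric] flip_triple[OF assms(4)] by (rule swap_triple)
      then show ?thesis using 3 assms(1-3) by metis
    next
      case 4
      then have z: "z \<noteq> p" "z \<noteq> q" "z \<noteq> r" by auto
      have "Delta p (lie (gen z) (gen r)) \<in> S"
        using assms(1,3) z(1,2) assms(4) by (rule replace_triple)
      with z(1)[symmetric] assms(2) z(3) have "Delta z (lie (gen p) (gen r)) \<in> S"
        by (rule swap_triple)
      then show ?thesis using z assms(2) by metis
    qed
  qed
  then obtain q r where qr: "z \<noteq> q" "z \<noteq> r" "q \<noteq> r" "Delta z (lie (gen q) (gen r)) \<in> S" by blast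
  have "\<exists>r. z \<noteq> r \<and> a \<noteq> r \<and> Delta z (lie (gen a) (gen r)) \<in> S"
  proof -
    consider "a = q" | "a = r" | "a \<noteq> q" "a \<noteq> r" by blast
    then show ?thesis
    proof cases
      case 1
      then show ?thesis using qr by metis
    next
      case 2
      then show ?thesis using qr flip_triple[OF qr(4)] by metis
    next
      case 3
      have "Delta z (lie (gen a) (gen r)) \<in> S"
        using qr(1,3) zab(1)[symmetric] 3(1) qr(4) by (rule replace_triple)
      then show ?thesis using qr(2) 3(2) by metis
    qed
  qed
  then obtain r where r: "z \<noteq> r" "a \<noteq> r" "Delta z (lie (gen a) (gen r)) \<in> S" by blast
  show ?thesis
  proof (cases "b = r")
    case False
    have "Delta z (lie (gen b) (gen a)) \<in> S"
      using r(1) r(2)[symmetric] zab(2)[symmetric] False flip_triple[OF r(3)] by (rule replace_triple)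
    then show ?thesis by (rule flip_triple)
  qed (use r in simp)
qed

text \<open>For two letters \<open>AD p 1\<close> is the single derivation
  \<open>q \<mapsto> [p,q]\<close>. Since \<open>p \<mapsto> q\<close> kills \<open>[p,q]\<close>,
  bracketing with it only transfers the source from \<open>q\<close> to \<open>p\<close>, up to
  sign.\<close>

lemma two_letters:
  assumes "CARD('n) = 2" "AD p 1 \<in> S" "length ws = 2"
  shows "Delta i (word ws) \<in> S"
proof -
  obtain q where q: "q \<noteq> p" "UNIV = {p, q}"
    using assms(1) by (metis (no_types, opaque_lifting) UNIV_I card_2_iff insert_commute insert_iff singletonD)
  then have pq: "j = p \<or> j = q" for j by blast
  let ?w = "lie (gen p) (gen q) :: ('n, 'd) nilp_lie"
  have "AD p 1 = Delta q ?w"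
  proof (rule deriv_eqI)
    fix j
    show "apply_deriv (AD p 1) (gen j) = apply_deriv (Delta q ?w) (gen j)"
      using pq[of j] q by (auto simp: AD_def lie_self)
  qed
  then have Dq: "Delta q ?w \<in> S" using assms(2) by simp
  then have "- lie (Delta p (gen q)) (Delta q ?w) \<in> S"
    using q by (intro subspace_neg[OF S] move) auto
  moreover have "- lie (Delta p (gen q)) (Delta q ?w) = Delta p ?w"
  proof (rule deriv_eqI)
    fix j
    show "apply_deriv (- lie (Delta p (gen q)) (Delta q ?w)) (gen j) = apply_deriv (Delta p ?w) (gen j)"
      using q(1) by (simp add: uminus_deriv.rep_eq lie_deriv.rep_eq linear_0[OF linear_apply_deriv]
          apply_deriv_lie lie_self)
  qed
  ultimately have "Delta p ?w \<in> S" by simp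
  then have D: "Delta i ?w \<in> S" for i using Dq pq[of i] by auto
  obtain a b where ws: "ws = [a, b]"
    using assms(3) by (auto simp: numeral_2_eq_2 length_Suc_conv)
  show ?thesis
    using pq[of a] pq[of b] D[of i] flip_triple[OF D[of i]] Delta_zero_S[of i]
    by (auto simp: ws lie_self)
qed

lemma all_words:
  assumes le: "CARD('d) \<le> CARD('n) * (CARD('n) - 1)"
    and AD: "\<And>k. 1 \<le> k \<Longrightarrow> k < CARD('d) \<Longrightarrow> AD p k \<in> S"
    and D: "3 \<le> CARD('n) \<Longrightarrow> p \<noteq> q \<and> p \<noteq> r \<and> q \<noteq> r \<and> Delta p (lie (gen q) (gen r)) \<in> S"
    and k: "1 \<le> k" "k < CARD('d)" and ws: "length ws = Suc k"
  shows "Delta i (word ws) \<in> S"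
proof (cases "3 \<le> CARD('n)")
  case True
  from k ws show ?thesis
  proof (induction k arbitrary: i ws rule: less_induct)
    case (less k)
    interpret degree_step S k p
    proof
      show "Delta i (word ws) \<in> S" if "2 \<le> length ws" "length ws \<le> k" for i ws
        using less.IH[of "length ws - 1" ws i] less.prems that by simp
    qed (use True AD less.prems all_triples D in blast)+
    show ?case
      using less.prems le by (intro degree_step) auto
  qed
next
  case False
  \<comment> \<open>The bound reads \<open>CARD('d) \<le> 0\<close> for one letter, and it leaves
    only degree 1 for two letters.\<close>
  have "CARD('n) \<noteq> 0" "CARD('n) \<noteq> 1" using le k by auto
  with False have two: "CARD('n) = 2" by linarith
  with le k have "k = 1" by simp
  then show ?thesis using two_letters[OF two] AD[of 1] k ws by simp
qed

end

section \<open>The grading of the derivation algebra\<close>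

lemma der_compI:
  assumes "\<And>j. apply_deriv D (gen j) \<in> nilp_comp (Suc k)"
  shows "D \<in> der_comp k"
proof -
  have "apply_deriv D (word ws) \<in> nilp_comp (length ws + k)" for ws
  proof (induction ws)
    case Nil
    show ?case by (simp add: linear_0[OF linear_apply_deriv] subspace_0[OF subspace_nilp_comp])
  next
    case (Cons x ws)
    show ?case
    proof (cases "ws = []")
      case True
      then show ?thesis using assms[of x] by simp
    next
      case False
      have "lie (apply_deriv D (gen x)) (word ws) \<in> nilp_comp (Suc k + length ws)"
        by (intro lie_nilp_comp assms word_in_nilp_comp refl)
      moreover have "lie (word [x]) (apply_deriv D (word ws)) \<in> nilp_comp (1 + (length ws + k))"
        by (intro lie_nilp_comp Cons.IH word_in_nilp_comp) simp
      ultimately show ?thesis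
        using False subspace_add[OF subspace_nilp_comp]
        by (simp add: right_bracket_Cons apply_deriv_lie add.commute)
    qed
  qed
  then have "nilp_comp i \<subseteq> apply_deriv D -` nilp_comp (i + k)" for i
    unfolding nilp_comp_words[of i]
    by (intro span_minimal linear_subspace_vimage[OF linear_apply_deriv] subspace_nilp_comp) auto
  then show ?thesis
    unfolding der_comp_def by blast
qed

lemma der_compD: "D \<in> der_comp k \<Longrightarrow> apply_deriv D (gen j) \<in> nilp_comp (Suc k)"
  using word_in_nilp_comp[of "[j]" 1] by (force simp: der_comp_def)

lemma lie_der_comp:
  assumes "D \<in> der_comp j" "E \<in> der_comp k"
  shows "lie D E \<in> der_comp (j + k)"
proof -
  have D: "apply_deriv D a \<in> nilp_comp (i + j)" and E: "apply_deriv E a \<in> nilp_comp (i + k)"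
    if "a \<in> nilp_comp i" for a i
    using assms that by (simp_all add: der_comp_def image_subset_iff)
  have "apply_deriv (lie D E) a \<in> nilp_comp (i + (j + k))" if "a \<in> nilp_comp i" for a i
    unfolding lie_deriv.rep_eq using D[OF E[OF that]] E[OF D[OF that]]
    by (intro subspace_diff[OF subspace_nilp_comp]) (simp_all add: ac_simps)
  then show ?thesis by (simp add: der_comp_def image_subset_iff)
qed

lemma der_comp_eq_0:
  fixes D :: "('a, 'd) nilp_lie deriv"
  assumes "D \<in> der_comp k" "CARD('d) \<le> k"
  shows "D = 0"
  using nilp_comp_eq_0[OF der_compD[OF assms(1)]] assms(2)
  by (intro deriv_eqI) (simp add: zero_deriv.rep_eq)

lemma subspace_UL: "subspace UL"
  by (simp add: UL_def)

text \<open>From degree \<open>CARD('d)\<close> on, the values on generators lie beyond the class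
  and vanish. Brackets therefore stay in \<open>UL\<close> even if the degrees add up past the
  class.\<close>

lemma der_comp_UL:
  assumes "1 \<le> k" "D \<in> der_comp k"
  shows "D \<in> (UL :: ('a, 'd) nilp_lie deriv set)"
proof (cases "k < CARD('d)")
  case True
  then show ?thesis unfolding UL_def using assms by (intro span_base) auto
next
  case False
  then show ?thesis using der_comp_eq_0[OF assms(2)] subspace_0[OF subspace_UL] by simp
qed

text \<open>Degree \<open>j = 0\<close> gives stability under \<open>sl\<close>; positive
  \<open>j\<close> gives closure under brackets.\<close>

lemma lie_der_comp_UL:
  assumes "T \<in> der_comp j" "D \<in> UL"
  shows "lie T D \<in> UL"
proof -
  have "lie T E \<in> UL" if "E \<in> (\<Union>k\<in>{1..<CARD('b)}. der_comp k)" for E :: "('a, 'b) nilp_lie deriv"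
  proof -
    from that obtain k where "1 \<le> k" "E \<in> der_comp k" by auto
    then show ?thesis
      using der_comp_UL[OF _ lie_der_comp[OF assms(1)], of k E] by simp
  qed
  then show ?thesis
    using span_linear_image[OF linear_lie_right subspace_UL _ assms(2)[unfolded UL_def]] by blast
qed

lemma lie_subalgebra_UL: "lie_subalgebra (UL :: ('a, 'd) nilp_lie deriv set)"
proof -
  have "lie D E \<in> UL" if "D \<in> UL" "E \<in> UL" for D E :: "('a, 'd) nilp_lie deriv"
    using span_linear_image[OF linear_lie_left subspace_UL _ that(1)[unfolded UL_def]]
      lie_der_comp_UL[OF _ that(2)] by blast
  then show ?thesis by (simp add: lie_subalgebra_def subspace_UL)
qed

lemma sl_invariant_UL: "sl_invariant UL"
  unfolding sl_invariant_def sl_def using lie_der_comp_UL by blast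

lemma Delta_gen_sl:
  assumes "a \<noteq> b"
  shows "Delta a (gen b) \<in> (sl :: ('n::finite, 'd) nilp_lie deriv set)"
proof -
  have "Delta a (gen b) \<in> (der_comp 0 :: ('n, 'd) nilp_lie deriv set)"
    using word_in_nilp_comp[of "[b]" "Suc 0"]
    by (intro der_compI) (auto intro: subspace_0 subspace_nilp_comp)
  \<comment> \<open>Columns hold the images, so \<open>a \<mapsto> b\<close> is the matrix unit in
    row \<open>b\<close>, column \<open>a\<close>.\<close>
  moreover define A :: "real^'n^'n" where "A = (\<chi> i j. if i = b \<and> j = a then 1 else 0)"
  have "trace A = 0"
    using assms by (auto simp: trace_def A_def intro!: sum.neutral)
  moreover have "apply_deriv (Delta a (gen b) :: ('n, 'd) nilp_lie deriv) (gen j) =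
      (\<Sum>i\<in>UNIV. A $ i $ j *\<^sub>R gen i)" for j
  proof -
    have "(\<Sum>i\<in>UNIV. A $ i $ j *\<^sub>R gen i :: ('n, 'd) nilp_lie) =
        (\<Sum>i\<in>UNIV. if i = b then (if j = a then gen b else 0) else 0)"
      by (intro sum.cong) (auto simp: A_def)
    then show ?thesis by simp
  qed
  ultimately show ?thesis unfolding sl_def by blast
qed

lemma deriv_eq_sum_Delta: "D = (\<Sum>i\<in>UNIV. Delta i (apply_deriv D (gen i)))"
  for D :: "('n::finite, 'd) nilp_lie deriv"
proof (rule deriv_eqI)
  fix j
  have "apply_deriv (\<Sum>i\<in>I. Delta i (g i)) (gen j) = (\<Sum>i\<in>I. if j = i then g i else 0)"
    for I and g :: "'n \<Rightarrow> ('n, 'd) nilp_lie"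
    by (induction I rule: infinite_finite_induct) (simp_all add: zero_deriv.rep_eq plus_deriv.rep_eq)
  from this[of "\<lambda>i. apply_deriv D (gen i)" UNIV]
  show "apply_deriv D (gen j) = apply_deriv (\<Sum>i\<in>UNIV. Delta i (apply_deriv D (gen i))) (gen j)"
    by simp
qed

theorem theorem1p4p11:
  fixes n d :: nat and x :: "nat \<Rightarrow> 'n::finite"
  assumes n: "n = CARD('n)"
    and d: "d = CARD('d::finite)"
    and le: "d \<le> n * (n - 1)"
    and x: "bij_betw x {1..n} UNIV"
  shows "sl_lie_generated
           ({AD (x 1) k | k. 1 \<le> k \<and> k < d} \<union>
            (if n \<ge> 3 then {Delta (x 1) (lie (gen (x 2)) (gen (x 3)))} else {}))
         = (UL :: ('n, 'd) nilp_lie deriv set)"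
proof -
  define G :: "('n, 'd) nilp_lie deriv set" where
    "G = {AD (x 1) k | k. 1 \<le> k \<and> k < d} \<union>
      (if n \<ge> 3 then {Delta (x 1) (lie (gen (x 2)) (gen (x 3)))} else {})"
  have "AD (x 1) k \<in> (UL :: ('n, 'd) nilp_lie deriv set)" if "1 \<le> k" for k
    using that by (intro der_comp_UL der_compI) (auto simp: AD_def ad_power_word intro!: word_in_nilp_comp
        simp del: map_append)
  moreover have "Delta (x 1) (lie (gen (x 2)) (gen (x 3))) \<in> (UL :: ('n, 'd) nilp_lie deriv set)"
    using word_in_nilp_comp[of "[x 2, x 3]" 2] subspace_0[OF subspace_nilp_comp]
    by (intro der_comp_UL[of 1] der_compI) (auto simp: numeral_2_eq_2)
  ultimately have "G \<subseteq> UL"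
    by (auto simp: G_def)
  then have "sl_lie_generated G \<subseteq> UL"
    unfolding sl_lie_generated_def by (intro hull_minimal conjI lie_subalgebra_UL sl_invariant_UL)
  moreover have "UL \<subseteq> S" if closed: "lie_subalgebra S" "sl_invariant S" "G \<subseteq> S" for S
  proof -
    interpret sl_closed S
    proof
      show "lie (Delta a (gen b)) D \<in> S" if "a \<noteq> b" "D \<in> S" for a b D
      proof -
        have "Delta a (gen b) \<in> (sl :: ('n, 'd) nilp_lie deriv set)"
          using that(1) by (rule Delta_gen_sl)
        then show ?thesis
          using closed(2) that(2) by (simp add: sl_invariant_def)
      qed
    qed (use closed(1) in \<open>auto simp: lie_subalgebra_def\<close>)
    have words: "Delta i (word ws) \<in> S" if "1 \<le> k" "k < CARD('d)" "length ws = Suc k" for i k ws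
    proof (rule all_words[OF _ _ _ that, where p = "x 1" and q = "x 2" and r = "x 3"])
      show "CARD('d) \<le> CARD('n) * (CARD('n) - 1)" using le n d by simp
      show "AD (x 1) k \<in> S" if "1 \<le> k" "k < CARD('d)" for k
        using that closed(3) d by (auto simp: G_def)
      show "x 1 \<noteq> x 2 \<and> x 1 \<noteq> x 3 \<and> x 2 \<noteq> x 3 \<and> Delta (x 1) (lie (gen (x 2)) (gen (x 3))) \<in> S"
        if "3 \<le> CARD('n)"
        using that closed(3) n inj_on_eq_iff[OF bij_betw_imp_inj_on[OF x]] by (simp add: G_def)
    qed
    \<comment> \<open>A derivation is the sum of the \<open>Delta i\<close> of its values, and these
      values are combinations of words of length \<open>Suc k\<close>.\<close>
    have "der_comp k \<subseteq> S" if k: "1 \<le> k" "k < CARD('d)" for k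
    proof
      fix D :: "('n, 'd) nilp_lie deriv"
      assume "D \<in> der_comp k"
      then have "apply_deriv D (gen i) \<in> span (word ` {ws. length ws = Suc k})" for i
        unfolding nilp_comp_words[symmetric] by (rule der_compD)
      moreover have "Delta i b \<in> S" if "b \<in> word ` {ws. length ws = Suc k}" for i b
        using that words[OF k] by blast
      ultimately have "Delta i (apply_deriv D (gen i)) \<in> S" for i
        using span_linear_image[OF linear_Delta S] by blast
      then show "D \<in> S"
        by (subst deriv_eq_sum_Delta) (intro subspace_sum S)
    qed
    then show "UL \<subseteq> S"
      unfolding UL_def by (intro span_minimal S UN_least) simp_all
  qed
  then have "UL \<subseteq> sl_lie_generated G"
    unfolding sl_lie_generated_def hull_def by blast
  ultimately show ?thesis
    unfolding G_def by blast
qed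

end
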